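(* Let $\gamma:[t_0,+\infty)\to(0,+\infty)$ be a nonincreasing and twice continuously differentiable function such that, for some $\beta\in(0,\frac13]$, $$\ddot\gamma(t)\ge 2\beta^2\gamma(t)^3\quad\forall t\ge t_0,\qquad\text{and}\qquad \int_{t_0}^{+\infty}\gamma(t)\,dt=+\infty,$$ and let $\delta(t)=\frac{1}{\beta_0\gamma(t)}$ with $\beta_0\in[2\beta,1-\beta]$. Let $p(t)=e^{\int_{t_0}^t\gamma(s)\,ds}$, and let $\epsilon_1:[t_0,+\infty)\to\mathbb{R}^{n_1}$ and $\epsilon_2:[t_0,+\infty)\to\mathbb{R}^{n_2}$ be locally integrable functions such that $$\int_{t_0}^{+\infty}p(t)^\beta\|\epsilon_i(t)\|\,dt<+\infty,\qquad i=1,2.$$ Suppose that $(x(t),y(t),\lambda(t))$ is a global solution of the perturbed dynamical system (P) (given in the context) and $(x^*,y^*,\lambda^* )\in\Omega$. Then: (a) $\mathcal{L}(x(t),y(t),\lambda^* )-\mathcal{L}(x^*,y^*,\lambda^* )=\mathcal{O}(p(t)^{-2\beta})$. (b) $\|Ax(t)+By(t)-b\|=\mathcal{O}(p(t)^{-\beta})$. (c) $\int_{t_0}^{+\infty}p(t)^{2\beta}\gamma(t)\|Ax(t)+By(t)-b\|^2\,dt<+\infty$. Moreover: Case I: if $\beta<\frac13$ and $\beta_0\in(2\beta,1-\beta)$, then (d) $\int_{t_0}^{+\infty}p(t)^{2\beta}\gamma(t)\big(\mathcal{L}(x(t),y(t),\lambda^* )-\mathcal{L}(x^*,y^*,\lambda^*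 )\big)\,dt<+\infty$; (e) $\int_{t_0}^{+\infty}p(t)^{2\beta}\gamma(t)\big(\|\dot x(t)\|^2+\|\dot y(t)\|^2+\|\dot\lambda(t)\|^2\big)\,dt<+\infty$; (f) $\|\dot x(t)\|+\|\dot y(t)\|+\|\dot\lambda(t)\|=\mathcal{O}(p(t)^{-\beta})$. Case II: if $\beta=\frac13$ and $\beta_0=\frac23$, then for any $\tau\in(0,\frac13)$ (d') $\int_{t_0}^{+\infty}p(t)^{2\tau}\gamma(t)\big(\mathcal{L}(x(t),y(t),\lambda^* )-\mathcal{L}(x^*,y^*,\lambda^* )\big)\,dt<+\infty$; (e') $\int_{t_0}^{+\infty}p(t)^{2\tau}\gamma(t)\big(\|\dot x(t)\|^2+\|\dot y(t)\|^2+\|\dot\lambda(t)\|^2\big)\,dt<+\infty$; (f') $\|\dot x(t)\|+\|\dot y(t)\|+\|\dot\lambda(t)\|=\mathcal{O}(p(t)^{-\tau})$.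
   Context: All spaces are Euclidean with inner product $\langle\cdot,\cdot\rangle$ and norm $\|\cdot\|$; $t_0>0$ is fixed. $f:\mathbb{R}^{n_1}\to\mathbb{R}$ and $g:\mathbb{R}^{n_2}\to\mathbb{R}$ are smooth (continuously differentiable) convex functions, $A\in\mathbb{R}^{m\times n_1}$, $B\in\mathbb{R}^{m\times n_2}$, $b\in\mathbb{R}^m$. $\Omega$ is the set of $(x^*,y^*,\lambda^* )\in\mathbb{R}^{n_1}\times\mathbb{R}^{n_2}\times\mathbb{R}^m$ with $-A^T\lambda^*=\nabla f(x^* )$, $-B^T\lambda^*=\nabla g(y^* )$, $Ax^*+By^*-b=0$; it is assumed that $\Omega\neq\emptyset$. The augmented Lagrangian is $$\mathcal{L}(x,y,\lambda)=f(x)+g(y)+\langle\lambda,Ax+By-b\rangle+\tfrac12\|Ax+By-b\|^2.$$ The perturbed dynamical system (P) is $$\begin{cases}\ddot{x}(t)+\gamma(t)\dot{x}(t)=-\nabla f(x(t))-A^T(\lambda(t)+\delta(t)\dot\lambda(t))-A^T(Ax(t)+By(t)-b)+\epsilon_1(t),\\ \ddot{y}(t)+\gamma(t)\dot{y}(t)=-\nabla g(y(t))-B^T(\lambda(t)+\delta(t)\dot\lambda(t))-B^T(Ax(t)+By(t)-b)+\epsilon_2(t),\\ \ddot{\lambda}(t)+\gamma(t)\dot{\lambda}(t)=A(x(t)+\delta(t)\dot{x}(t))+B(y(t)+\delta(t)\dot{y}(t))-b.\end{cases}$$ A global solution is a triple of $C^1$ functions on $[t_0,+\infty)$ with locally absolutely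 continuous first derivatives satisfying (P) for almost every $t\ge t_0$. All $\mathcal{O}(\cdot)$ statements are as $t\to+\infty$. *)

theory Defs
  imports "HOL-Analysis.Analysis" "HOL-Library.Landau_Symbols"
begin

definition gradient :: "('a::real_inner \<Rightarrow> real) \<Rightarrow> 'a \<Rightarrow> 'a" where
  "gradient f x = (THE D. GDERIV f x :> D)"

definition smooth_convex :: "('a::real_inner \<Rightarrow> real) \<Rightarrow> bool" where
  "smooth_convex f \<longleftrightarrow>
     f differentiable_on UNIV \<and> continuous_on UNIV (gradient f) \<and> convex_on UNIV f"

(* Functions on [t0, \<infinity>) are total functions on the reals of which only the values on {t0..} matter.
   Derivatives are therefore taken within {t0..}: one-sided at t0, two-sided at every t > t0. *)

definition tderiv :: "real \<Rightarrow> (real \<Rightarrow> 'a::real_normed_vector) \<Rightarrow> real \<Rightarrow> 'a" where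
  "tderiv t0 u t = vector_derivative u (at t within {t0..})"

definition C1_from :: "real \<Rightarrow> (real \<Rightarrow> 'a::real_normed_vector) \<Rightarrow> bool" where
  "C1_from t0 u \<longleftrightarrow> u differentiable_on {t0..} \<and> continuous_on {t0..} (tderiv t0 u)"

definition C2_from :: "real \<Rightarrow> (real \<Rightarrow> 'a::real_normed_vector) \<Rightarrow> bool" where
  "C2_from t0 u \<longleftrightarrow> C1_from t0 u \<and> C1_from t0 (tderiv t0 u)"

(* A pair (r, s) in D stands for the interval with endpoints r \<le> s. *)

definition abs_continuous_on :: "real \<Rightarrow> real \<Rightarrow> (real \<Rightarrow> 'a::real_normed_vector) \<Rightarrow> bool" where
  "abs_continuous_on a b u \<longleftrightarrow>
     (\<forall>e>0. \<exists>d>0. \<forall>D :: (real \<times> real) set.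
        finite D \<and>
        (\<forall>(r, s)\<in>D. a \<le> r \<and> r \<le> s \<and> s \<le> b) \<and>
        pairwise (\<lambda>(r, s) (r', s'). {r<..<s} \<inter> {r'<..<s'} = {}) D \<and>
        (\<Sum>(r, s)\<in>D. s - r) < d
        \<longrightarrow> (\<Sum>(r, s)\<in>D. norm (u s - u r)) < e)"

definition loc_abs_continuous_from :: "real \<Rightarrow> (real \<Rightarrow> 'a::real_normed_vector) \<Rightarrow> bool" where
  "loc_abs_continuous_from t0 u \<longleftrightarrow> (\<forall>T\<ge>t0. abs_continuous_on t0 T u)"

definition loc_integrable_from :: "real \<Rightarrow> (real \<Rightarrow> 'a::euclidean_space) \<Rightarrow> bool" where
  "loc_integrable_from t0 u \<longleftrightarrow> (\<forall>T\<ge>t0. u absolutely_integrable_on {t0..T})"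

(* The points (x, y, l) satisfying the optimality (KKT) conditions of
   min f(x) + g(y) subject to A x + B y = b. *)

definition Omega ::
  "(real^'n1 \<Rightarrow> real) \<Rightarrow> (real^'n2 \<Rightarrow> real) \<Rightarrow> real^'n1^'m \<Rightarrow> real^'n2^'m \<Rightarrow> real^'m
     \<Rightarrow> ((real^'n1) \<times> (real^'n2) \<times> (real^'m)) set" where
  "Omega f g A B b =
     {(x, y, l). - (transpose A *v l) = gradient f x \<and>
                 - (transpose B *v l) = gradient g y \<and>
                 A *v x + B *v y - b = 0}"

definition aug_lagrangian ::
  "(real^'n1 \<Rightarrow> real) \<Rightarrow> (real^'n2 \<Rightarrow> real) \<Rightarrow> real^'n1^'m \<Rightarrow> real^'n2^'m \<Rightarrow> real^'m
     \<Rightarrow> real^'n1 \<Rightarrow> real^'n2 \<Rightarrow> real^'m \<Rightarrow> real" where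
  "aug_lagrangian f g A B b x y l =
     f x + g y + l \<bullet> (A *v x + B *v y - b) + 1/2 * (norm (A *v x + B *v y - b))\<^sup>2"

(* The system only has to hold almost everywhere; since tderiv is total, existence of the
   second derivatives is required explicitly at those points. *)

definition global_solution ::
  "real \<Rightarrow> (real^'n1 \<Rightarrow> real) \<Rightarrow> (real^'n2 \<Rightarrow> real) \<Rightarrow> real^'n1^'m \<Rightarrow> real^'n2^'m \<Rightarrow> real^'m
     \<Rightarrow> (real \<Rightarrow> real) \<Rightarrow> (real \<Rightarrow> real) \<Rightarrow> (real \<Rightarrow> real^'n1) \<Rightarrow> (real \<Rightarrow> real^'n2)
     \<Rightarrow> (real \<Rightarrow> real^'n1) \<Rightarrow> (real \<Rightarrow> real^'n2) \<Rightarrow> (real \<Rightarrow> real^'m) \<Rightarrow> bool" where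
  "global_solution t0 f g A B b \<gamma> \<delta> \<epsilon>1 \<epsilon>2 x y l \<longleftrightarrow>
     C1_from t0 x \<and> C1_from t0 y \<and> C1_from t0 l \<and>
     loc_abs_continuous_from t0 (tderiv t0 x) \<and>
     loc_abs_continuous_from t0 (tderiv t0 y) \<and>
     loc_abs_continuous_from t0 (tderiv t0 l) \<and>
     (AE t in lebesgue. t \<ge> t0 \<longrightarrow>
        tderiv t0 x differentiable (at t within {t0..}) \<and>
        tderiv t0 y differentiable (at t within {t0..}) \<and>
        tderiv t0 l differentiable (at t within {t0..}) \<and>
        tderiv t0 (tderiv t0 x) t + \<gamma> t *\<^sub>R tderiv t0 x t =
          - gradient f (x t) - transpose A *v (l t + \<delta> t *\<^sub>R tderiv t0 l t)
          - transpose A *v (A *v x t + B *v y t - b) + \<epsilon>1 t \<and>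
        tderiv t0 (tderiv t0 y) t + \<gamma> t *\<^sub>R tderiv t0 y t =
          - gradient g (y t) - transpose B *v (l t + \<delta> t *\<^sub>R tderiv t0 l t)
          - transpose B *v (A *v x t + B *v y t - b) + \<epsilon>2 t \<and>
        tderiv t0 (tderiv t0 l) t + \<gamma> t *\<^sub>R tderiv t0 l t =
          A *v (x t + \<delta> t *\<^sub>R tderiv t0 x t) + B *v (y t + \<delta> t *\<^sub>R tderiv t0 y t) - b)"

end

theory Submission
  imports Defs
begin

text \<open>
  The triple \<open>z = (x, y, \<lambda>)\<close> obeys a single damped equation
  \<open>z'' + \<gamma> z' = - G(z) - M(z - z\<^sup>* + \<delta> z') + \<epsilon>\<close>, where \<open>G\<close> is the gradient in the primal variables of
  the Lagrangian gap \<open>\<Phi>(z) = L(x, y, \<lambda>\<^sup>*) - L(x\<^sup>*, y\<^sup>*, \<lambda>\<^sup>*)\<close> and the linear map \<open>M\<close>, which carries the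
  coupling through \<open>A\<close> and \<open>B\<close>, is skew-symmetric. Let \<open>w = z - z\<^sup>*\<close>, \<open>m = \<beta>0 \<gamma> w + z'\<close> and
  \<open>\<sigma> = \<beta>0 (1 - \<beta>0 - 2 \<beta>) \<gamma>\<^sup>2 - \<beta>0 \<gamma>'\<close>. The proof rests on the Lyapunov function

  \<open>E = p\<^sup>2\<^sup>\<beta> (\<Phi>(z) + |m|\<^sup>2 / 2 + \<sigma> |w|\<^sup>2 / 2)\<close>.

  Because \<open>\<delta> = 1 / (\<beta>0 \<gamma>)\<close>, the argument of \<open>M\<close> is a multiple of \<open>m\<close>, so the coupling drops out of
  \<open>E'\<close>. Convexity gives \<open>G(z) \<bullet> w \<ge> \<Phi>(z) + |A x + B y - b|\<^sup>2 / 2\<close>, and \<open>\<sigma>\<close> is chosen to cancel the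
  products \<open>w \<bullet> z'\<close>. What remains in front of \<open>|w|\<^sup>2\<close> is nonpositive by \<open>\<gamma>'' \<ge> 2 \<beta>\<^sup>2 \<gamma>\<^sup>3\<close> and by its
  consequence \<open>\<gamma>' \<le> - \<beta> \<gamma>\<^sup>2\<close> (\<open>damping_decay\<close>), which together with \<open>\<beta>0 \<le> 1 - \<beta>\<close> also gives \<open>\<sigma> \<ge> 0\<close>. Thus (\<open>lyap_deriv\<close>)

  \<open>E' \<le> - p\<^sup>2\<^sup>\<beta> \<gamma> ((\<beta>0 - 2 \<beta>) \<Phi> + \<beta>0 |A x + B y - b|\<^sup>2 / 2 + (1 - \<beta> - \<beta>0) |z'|\<^sup>2) + p\<^sup>\<beta> |\<epsilon>| sqrt (2 E)\<close>

  almost everywhere. As \<open>p\<^sup>\<beta> |\<epsilon>|\<close> is integrable, a Gronwall argument bounds \<open>E\<close>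
  (\<open>lyap_bounded\<close>) and the total dissipation. The bound on \<open>E\<close> yields the decay rates and the
  bound on the dissipation the integral estimates; those on \<open>\<Phi>\<close> and \<open>z'\<close> need their coefficients
  to be positive. In the critical case \<open>\<beta> = 1/3\<close>, \<open>\<beta>0 = 2/3\<close> both vanish, but every \<open>\<tau>\<close> with \<open>0 < \<tau> < 1/3\<close>
  satisfies the hypotheses in place of \<open>\<beta>\<close>, with strict inequalities.

  Since \<open>z'\<close> is merely absolutely continuous, so is \<open>E\<close>, and the differential inequality is
  integrated by a fundamental theorem of calculus for absolutely continuous functions
  (\<open>fundamental_theorem_of_calculus_abs_continuous\<close>), which has a direct proof for the gauge
  integral.
\<close>

section \<open>Absolute continuity and the fundamental theorem of calculus\<close>

lemma abs_continuous_onD: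
  assumes "abs_continuous_on a b u" "e > 0"
  obtains d where "d > 0" "\<And>D. \<lbrakk>finite D; \<And>r s. (r, s) \<in> D \<Longrightarrow> a \<le> r \<and> r \<le> s \<and> s \<le> b;
     pairwise (\<lambda>(r, s) (r', s'). {r<..<s} \<inter> {r'<..<s'} = {}) D; (\<Sum>(r, s)\<in>D. s - r) < d\<rbrakk>
     \<Longrightarrow> (\<Sum>(r, s)\<in>D. norm (u s - u r)) < e"
proof -
  from assms obtain d where d: "d > 0" and D: "\<forall>D :: (real \<times> real) set.
        finite D \<and> (\<forall>(r, s)\<in>D. a \<le> r \<and> r \<le> s \<and> s \<le> b) \<and>
        pairwise (\<lambda>(r, s) (r', s'). {r<..<s} \<inter> {r'<..<s'} = {}) D \<and>
        (\<Sum>(r, s)\<in>D. s - r) < d \<longrightarrow> (\<Sum>(r, s)\<in>D. norm (u s - u r)) < e"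
    unfolding abs_continuous_on_def by meson
  show thesis
  proof (rule that[OF d])
    fix D :: "(real \<times> real) set"
    assume "finite D" "\<And>r s. (r, s) \<in> D \<Longrightarrow> a \<le> r \<and> r \<le> s \<and> s \<le> b"
       "pairwise (\<lambda>(r, s) (r', s'). {r<..<s} \<inter> {r'<..<s'} = {}) D" "(\<Sum>(r, s)\<in>D. s - r) < d"
    then have "finite D \<and> (\<forall>(r, s)\<in>D. a \<le> r \<and> r \<le> s \<and> s \<le> b) \<and>
        pairwise (\<lambda>(r, s) (r', s'). {r<..<s} \<inter> {r'<..<s'} = {}) D \<and> (\<Sum>(r, s)\<in>D. s - r) < d"
      by (intro conjI) (blast | assumption)+
    then show "(\<Sum>(r, s)\<in>D. norm (u s - u r)) < e"
      by (rule D[rule_format])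
  qed
qed

text \<open>
  Absolute continuity in the vocabulary of gauge integration: the intervals of a partial division
  do not overlap, so those lying in a set of small measure have small total length. A tag is
  recovered from its interval (two non-degenerate intervals with a common interior coincide, and a
  degenerate one contains only its tag), which is what allows the tagged family to be read as a
  plain set of pairs of end points.
\<close>
lemma tagged_partial_division_increments_small:
  fixes u :: "real \<Rightarrow> 'a::real_normed_vector"
  assumes ac: "abs_continuous_on a b u" and "e > 0"
  obtains d where "d > 0"
    "\<And>q G. \<lbrakk>q tagged_partial_division_of {a..b}; \<And>x K. (x, K) \<in> q \<Longrightarrow> K \<subseteq> G;
       G \<in> lmeasurable; measure lebesgue G < d\<rbrakk>
     \<Longrightarrow> (\<Sum>(x, K)\<in>q. norm (u (Sup K) - u (Inf K))) < e"
proof -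
  obtain d where d: "d > 0" and D: "\<And>D. \<lbrakk>finite D; \<And>r s. (r, s) \<in> D \<Longrightarrow> a \<le> r \<and> r \<le> s \<and> s \<le> b;
     pairwise (\<lambda>(r, s) (r', s'). {r<..<s} \<inter> {r'<..<s'} = {}) D; (\<Sum>(r, s)\<in>D. s - r) < d\<rbrakk>
     \<Longrightarrow> (\<Sum>(r, s)\<in>D. norm (u s - u r)) < e"
    using abs_continuous_onD[OF ac \<open>e > 0\<close>] by blast
  show thesis
  proof (rule that[OF d])
    fix q :: "(real \<times> real set) set" and G
    assume q: "q tagged_partial_division_of {a..b}" and KG: "\<And>x K. (x, K) \<in> q \<Longrightarrow> K \<subseteq> G"
      and G: "G \<in> lmeasurable" "measure lebesgue G < d"
    note qD = tagged_partial_division_ofD[OF q]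
    define ends where "ends = (\<lambda>(x::real, K::real set). (Inf K, Sup K))"
    have K: "K = {Inf K..Sup K} \<and> Inf K \<le> x \<and> x \<le> Sup K \<and> a \<le> Inf K \<and> Sup K \<le> b" if xK: "(x, K) \<in> q" for x K
    proof -
      obtain r s where rs: "K = cbox r s"
        using qD(4)[OF xK] by blast
      have x: "x \<in> {r..s}"
        using qD(2)[OF xK] rs by simp
      moreover have "{r..s} \<subseteq> {a..b}"
        using qD(3)[OF xK] rs by simp
      ultimately show ?thesis
        using rs by auto
    qed
    have int: "interior K = {Inf K<..<Sup K}" if "(x, K) \<in> q" for x K
    proof -
      have "interior K = interior {Inf K..Sup K}"
        using K[OF that] by argo
      then show ?thesis
        by simp
    qed
    have inj: "inj_on ends q"
    proof (rule inj_onI, clarify)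
      fix x K x' K'
      assume xK: "(x, K) \<in> q" "(x', K') \<in> q" and eq: "ends (x, K) = ends (x', K')"
      have KK': "K' = K"
        using K[OF xK(1)] K[OF xK(2)] eq by (simp add: ends_def)
      show "x = x' \<and> K = K'"
      proof (cases "Inf K < Sup K")
        case True
        then have "interior K \<inter> interior K' \<noteq> {}"
          using int[OF xK(1)] KK' by (auto simp: dense)
        then show ?thesis
          using qD(5)[OF xK] by auto
      next
        case False
        then show ?thesis
          using K[OF xK(1)] K[OF xK(2)] KK' by auto
      qed
    qed
    have meas: "snd p \<in> lmeasurable" if pq: "p \<in> q" for p
    proof -
      obtain r s where "snd p = cbox r s"
        using qD(4)[of "fst p" "snd p"] pq by auto
      then show ?thesis
        by simp
    qed
    have "(\<Sum>(x, K)\<in>q. Sup K - Inf K) = (\<Sum>p\<in>q. measure lebesgue (snd p))"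
    proof (rule sum.cong[OF refl], clarify)
      fix x K assume "(x, K) \<in> q"
      then have "measure lebesgue K = measure lebesgue {Inf K..Sup K}" "Inf K \<le> Sup K"
        using K by (metis, force)
      then show "Sup K - Inf K = measure lebesgue (snd (x, K))"
        by simp
    qed
    also have "\<dots> = measure lebesgue (\<Union>(snd ` q))"
    proof (rule measure_negligible_finite_Union_image[symmetric])
      show "finite q" by (rule qD(1))
      show "snd p \<in> lmeasurable" if "p \<in> q" for p
        using meas that by blast
      show "pairwise (\<lambda>x y. negligible (snd x \<inter> snd y)) q"
      proof (rule pairwiseI)
        fix z z' assume z: "z \<in> q" "z' \<in> q" "z \<noteq> z'"
        obtain x K x' K' where zz: "z = (x, K)" "z' = (x', K')"
          by (cases z, cases z')
        have xK: "(x, K) \<in> q" "(x', K') \<in> q" and ne: "x \<noteq> x' \<or> K \<noteq> K'"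
          using z zz by auto
        have "interior (K \<inter> K') = {}"
          using qD(5)[OF xK] ne by auto
        moreover have "convex (K \<inter> K')"
          using qD(4)[OF xK(1)] qD(4)[OF xK(2)] by (auto intro: convex_Int)
        ultimately show "negligible (snd z \<inter> snd z')"
          unfolding zz snd_conv using negligible_convex_interior by blast
      qed
    qed
    also have "\<dots> \<le> measure lebesgue G"
    proof (rule measure_mono_fmeasurable)
      show "\<Union>(snd ` q) \<subseteq> G" using KG by force
      show "\<Union>(snd ` q) \<in> sets lebesgue"
        using qD(1) meas by (intro sets.finite_Union) (auto intro: fmeasurableD)
    qed (rule G)
    also note G(2)
    finally have len: "(\<Sum>(x, K)\<in>q. Sup K - Inf K) < d" .
    have "(\<Sum>(r, s)\<in>ends ` q. norm (u s - u r)) < e"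
    proof (rule D)
      show "finite (ends ` q)" using qD(1) by simp
      show "a \<le> r \<and> r \<le> s \<and> s \<le> b" if rs: "(r, s) \<in> ends ` q" for r s
      proof -
        obtain x K where "(x, K) \<in> q" "r = Inf K" "s = Sup K"
          using rs by (auto simp: ends_def)
        then show ?thesis
          using K[of x K] by linarith
      qed
      show "pairwise (\<lambda>(r, s) (r', s'). {r<..<s} \<inter> {r'<..<s'} = {}) (ends ` q)"
      proof (rule pairwiseI)
        fix z z' assume z: "z \<in> ends ` q" "z' \<in> ends ` q" "z \<noteq> z'"
        obtain x K x' K' where xK: "(x, K) \<in> q" "(x', K') \<in> q" and zz: "z = (Inf K, Sup K)" "z' = (Inf K', Sup K')"
          using z(1,2) by (auto simp: ends_def)
        have "K \<noteq> K'"
          using zz z(3) by auto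
        then have "interior K \<inter> interior K' = {}"
          using qD(5)[OF xK] by simp
        then show "(case z of (r, s) \<Rightarrow> \<lambda>(r', s'). {r<..<s} \<inter> {r'<..<s'} = {}) z'"
          using int[OF xK(1)] int[OF xK(2)] unfolding zz by simp
      qed
      show "(\<Sum>(r, s)\<in>ends ` q. s - r) < d"
        using len by (subst sum.reindex[OF inj]) (simp add: ends_def split_def)
    qed
    then show "(\<Sum>(x, K)\<in>q. norm (u (Sup K) - u (Inf K))) < e"
      by (subst (asm) sum.reindex[OF inj]) (simp add: ends_def split_def)
  qed
qed

text \<open>The straddle lemma: the local estimate of the gauge proof at a point of differentiability.\<close>
lemma vector_derivative_straddle:
  fixes u :: "real \<Rightarrow> 'a::real_normed_vector"
  assumes "(u has_vector_derivative D) (at x within {a..b})" "e > 0"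
  obtains d where "d > 0" "\<And>r s. \<lbrakk>a \<le> r; r \<le> x; x \<le> s; s \<le> b; {r..s} \<subseteq> ball x d\<rbrakk>
    \<Longrightarrow> norm ((s - r) *\<^sub>R D - (u s - u r)) \<le> e * (s - r)"
proof -
  obtain d where d: "d > 0" and D: "\<And>y. \<lbrakk>y \<in> {a..b}; norm (y - x) < d\<rbrakk>
      \<Longrightarrow> norm (u y - u x - (y - x) *\<^sub>R D) \<le> e * norm (y - x)"
    using assms unfolding has_vector_derivative_def has_derivative_within_alt by blast
  show thesis
  proof (rule that[OF d])
    fix r s assume rs: "a \<le> r" "r \<le> x" "x \<le> s" "s \<le> b" "{r..s} \<subseteq> ball x d"
    then have "r \<in> ball x d" "s \<in> ball x d"
      using subsetD[OF rs(5), of r] subsetD[OF rs(5), of s] by simp_all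
    then have "norm (r - x) < d" "norm (s - x) < d"
      by (simp_all add: dist_norm norm_minus_commute)
    then have "norm (u r - u x - (r - x) *\<^sub>R D) \<le> e * norm (r - x)"
      and "norm (u s - u x - (s - x) *\<^sub>R D) \<le> e * norm (s - x)"
      using D[of r] D[of s] rs(1-4) by simp_all
    moreover have "norm ((s - r) *\<^sub>R D - (u s - u r))
       = norm ((u r - u x - (r - x) *\<^sub>R D) - (u s - u x - (s - x) *\<^sub>R D))"
      by (simp add: algebra_simps)
    moreover have "\<dots> \<le> norm (u r - u x - (r - x) *\<^sub>R D) + norm (u s - u x - (s - x) *\<^sub>R D)"
      by (rule norm_triangle_ineq4)
    moreover have "e * norm (r - x) + e * norm (s - x) = e * (s - r)"
      using rs(2,3) by (simp add: algebra_simps)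
    ultimately show "norm ((s - r) *\<^sub>R D - (u s - u r)) \<le> e * (s - r)"
      by linarith
  qed
qed

text \<open>
  For the gauge integral, integrability of the derivative is part of the conclusion. At a tag off \<open>N\<close> the
  straddle lemma controls the error; at a tag in \<open>N\<close> the gauge confines the interval to an open
  superset of \<open>N\<close> of small measure, and there absolute continuity makes the increments
  themselves small.
\<close>
theorem fundamental_theorem_of_calculus_abs_continuous:
  fixes u :: "real \<Rightarrow> 'a::banach"
  assumes ac: "abs_continuous_on a b u" and "a \<le> b" and N: "negligible N"
    and deriv: "\<And>t. t \<in> {a..b} - N \<Longrightarrow> (u has_vector_derivative u' t) (at t within {a..b})"
  shows "(u' has_integral (u b - u a)) {a..b}"
proof -
  \<comment> \<open>On \<open>N\<close> the integrand may be chosen freely; the value 0 leaves only the increments of \<open>u\<close> there.\<close>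
  define v where "v = (\<lambda>t. if t \<in> N then 0 else u' t)"
  have "(v has_integral (u b - u a)) (cbox a b)"
    unfolding has_integral
  proof (intro allI impI)
    fix e :: real assume "e > 0"
    define e1 where "e1 = e / (2 * (b - a + 1))"
    have e1: "e1 > 0"
      using \<open>e > 0\<close> \<open>a \<le> b\<close> by (simp add: e1_def)
    have "e1 * (b - a) < e1 * (b - a + 1)"
      using e1 by simp
    also have "\<dots> = e / 2"
      using \<open>a \<le> b\<close> by (simp add: e1_def field_simps)
    finally have e1_le: "e1 * (b - a) < e / 2" .
    obtain d where d: "d > 0" and small:
      "\<And>q G. \<lbrakk>q tagged_partial_division_of {a..b}; \<And>x K. (x, K) \<in> q \<Longrightarrow> K \<subseteq> G;
         G \<in> lmeasurable; measure lebesgue G < d\<rbrakk>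
       \<Longrightarrow> (\<Sum>(x, K)\<in>q. norm (u (Sup K) - u (Inf K))) < e / 2"
      using tagged_partial_division_increments_small[OF ac half_gt_zero[OF \<open>e > 0\<close>]] by blast
    obtain G where G: "open G" "N \<subseteq> G" "G \<in> lmeasurable" "measure lebesgue G < d"
    proof -
      obtain T where T: "open T" "N \<subseteq> T" "T - N \<in> lmeasurable" "emeasure lebesgue (T - N) < ennreal d"
        using sets_lebesgue_outer_open[OF _ d, of N] N
        by (metis negligible_imp_sets)
      have N0: "N \<in> null_sets lebesgue"
        using N negligible_iff_null_sets by blast
      have TN: "T = (T - N) \<union> N"
        using T by auto
      have "T \<in> lmeasurable"
        by (subst TN) (intro fmeasurable.Un T(3) negligible_imp_measurable[OF N])
      moreover have "measure lebesgue T = measure lebesgue (T - N)"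
        using N0 \<open>T \<in> lmeasurable\<close> by (simp add: measure_Diff_null_set fmeasurableD)
      ultimately show thesis
        using that[of T] T
        by (metis d emeasure_eq_measure2 ennreal_less_iff measure_nonneg)
    qed
    define fits where "fits = (\<lambda>t \<rho>. \<forall>r s. a \<le> r \<longrightarrow> r \<le> t \<longrightarrow> t \<le> s \<longrightarrow> s \<le> b \<longrightarrow> {r..s} \<subseteq> ball t \<rho>
      \<longrightarrow> norm ((s - r) *\<^sub>R u' t - (u s - u r)) \<le> e1 * (s - r))"
    have "\<exists>\<rho>>0. (t \<in> N \<longrightarrow> ball t \<rho> \<subseteq> G) \<and> (t \<in> {a..b} - N \<longrightarrow> fits t \<rho>)" for t
    proof -
      consider "t \<in> N" | "t \<in> {a..b} - N" | "t \<notin> N" "t \<notin> {a..b} - N"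
        by blast
      then show ?thesis
      proof cases
        case 1
        then show ?thesis
          using G(1,2) by (metis DiffD2 open_contains_ball subsetD)
      next
        case 2
        then obtain d where "d > 0" and "\<And>r s. \<lbrakk>a \<le> r; r \<le> t; t \<le> s; s \<le> b; {r..s} \<subseteq> ball t d\<rbrakk>
            \<Longrightarrow> norm ((s - r) *\<^sub>R u' t - (u s - u r)) \<le> e1 * (s - r)"
          using vector_derivative_straddle[OF deriv e1] by blast
        then have "fits t d"
          unfolding fits_def by blast
        then show ?thesis
          using 2 \<open>d > 0\<close> by blast
      next
        case 3
        then show ?thesis
          using zero_less_one by blast
      qed
    qed
    then obtain \<rho> where \<rho>: "\<And>t. \<rho> t > 0" "\<And>t. t \<in> N \<Longrightarrow> ball t (\<rho> t) \<subseteq> G"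
        "\<And>t. t \<in> {a..b} - N \<Longrightarrow> fits t (\<rho> t)"
      by metis
    show "\<exists>\<gamma>. gauge \<gamma> \<and> (\<forall>\<D>. \<D> tagged_division_of cbox a b \<and> \<gamma> fine \<D> \<longrightarrow>
             norm ((\<Sum>(x, K)\<in>\<D>. measure lborel K *\<^sub>R v x) - (u b - u a)) < e)"
    proof (intro exI[of _ "\<lambda>t. ball t (\<rho> t)"] conjI allI impI)
      show "gauge (\<lambda>t. ball t (\<rho> t))"
        using \<rho>(1) by (rule gauge_ball_dependent[rule_format])
      fix p assume "p tagged_division_of cbox a b \<and> (\<lambda>t. ball t (\<rho> t)) fine p"
      then have p: "p tagged_division_of {a..b}" and fine: "(\<lambda>t. ball t (\<rho> t)) fine p"
        by auto
      note pD = tagged_division_ofD[OF p]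
      define q where "q = {(x, K) \<in> p. x \<in> N}"
      define err where "err = (\<lambda>(x, K). measure lborel K *\<^sub>R v x - (u (Sup K) - u (Inf K)))"
      have qp: "q \<subseteq> p" "finite q" "finite (p - q)"
        using pD(1) by (auto simp: q_def intro: finite_subset)
      have K: "\<exists>r s. K = {r..s} \<and> r \<le> x \<and> x \<le> s \<and> a \<le> r \<and> s \<le> b" if xK: "(x, K) \<in> p" for x K
      proof -
        obtain r s where rs: "K = cbox r s"
          using pD(4)[OF xK] by blast
        have "x \<in> {r..s}" "{r..s} \<subseteq> {a..b}"
          using pD(2,3)[OF xK] rs by auto
        then show ?thesis
          using rs by (intro exI[of _ r] exI[of _ s]) auto
      qed
      have "(\<Sum>(x, K)\<in>p. measure lborel K *\<^sub>R v x) - (u b - u a) = sum err p"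
        by (subst additive_tagged_division_1[OF \<open>a \<le> b\<close> p, of u, symmetric])
          (simp only: err_def split_def sum_subtractf)
      also have "\<dots> = sum err (p - q) + sum err q"
        using qp pD(1) by (simp add: sum.subset_diff)
      finally have eq: "(\<Sum>(x, K)\<in>p. measure lborel K *\<^sub>R v x) - (u b - u a) = sum err (p - q) + sum err q" .
      have "norm (sum err q) \<le> (\<Sum>(x, K)\<in>q. norm (u (Sup K) - u (Inf K)))"
        by (rule sum_norm_le) (auto simp: err_def q_def v_def norm_minus_commute)
      also have "\<dots> < e / 2"
      proof (rule small[OF _ _ G(3,4)])
        show "q tagged_partial_division_of {a..b}"
          using p qp(1) unfolding tagged_division_of_def by (metis tagged_partial_division_subset)
        show "K \<subseteq> G" if xK: "(x, K) \<in> q" for x K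
        proof -
          have "(x, K) \<in> p" "x \<in> N"
            using xK by (auto simp: q_def)
          then show ?thesis
            using fineD[OF fine] \<rho>(2)[of x] by blast
        qed
      qed
      finally have 1: "norm (sum err q) < e / 2" .
      have "norm (sum err (p - q)) \<le> (\<Sum>(x, K)\<in>p - q. e1 * (Sup K - Inf K))"
      proof (rule sum_norm_le, clarify)
        fix x K assume xK: "(x, K) \<in> p" "(x, K) \<notin> q"
        then obtain r s where rs: "K = {r..s}" "r \<le> x" "x \<le> s" "a \<le> r" "s \<le> b"
          using K by blast
        have "x \<notin> N"
          using xK by (simp add: q_def)
        have "{r..s} \<subseteq> ball x (\<rho> x)"
          using fineD[OF fine xK(1)] rs(1) by simp
        moreover have "fits x (\<rho> x)"
          using rs \<open>x \<notin> N\<close> by (intro \<rho>(3)) simp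
        ultimately have "norm ((s - r) *\<^sub>R u' x - (u s - u r)) \<le> e1 * (s - r)"
          using rs(2-5) unfolding fits_def by blast
        then show "norm (err (x, K)) \<le> e1 * (Sup K - Inf K)"
          using rs \<open>x \<notin> N\<close> by (simp add: err_def v_def)
      qed
      also have "\<dots> \<le> (\<Sum>(x, K)\<in>p. e1 * (Sup K - Inf K))"
      proof (rule sum_mono2)
        fix z assume "z \<in> p - (p - q)"
        then obtain x K where "z = (x, K)" "(x, K) \<in> p"
          by (cases z) auto
        then show "0 \<le> (case z of (x, K) \<Rightarrow> e1 * (Sup K - Inf K))"
          using K[of x K] e1 by auto
      qed (use pD in auto)
      also have "\<dots> = e1 * (b - a)"
        using additive_tagged_division_1[OF \<open>a \<le> b\<close> p, of "\<lambda>x. x"]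
        by (simp add: split_def flip: sum_distrib_left)
      also have "\<dots> < e / 2"
        by (rule e1_le)
      finally have "norm (sum err (p - q)) < e / 2" .
      with 1 show "norm ((\<Sum>(x, K)\<in>p. measure lborel K *\<^sub>R v x) - (u b - u a)) < e"
        unfolding eq using norm_triangle_ineq[of "sum err (p - q)" "sum err q"] by linarith
    qed
  qed
  then have "(v has_integral (u b - u a)) {a..b}"
    by simp
  then show ?thesis
    by (rule has_integral_spike[OF N, rotated]) (auto simp: v_def)
qed

text \<open>
  The form in which the differential inequality for the energy is integrated.
\<close>
corollary abs_continuous_increment_le:
  fixes h :: "real \<Rightarrow> real"
  assumes ac: "abs_continuous_on a b h" and "a \<le> b" and N: "negligible N"
    and deriv: "\<And>t. t \<in> {a..b} - N \<Longrightarrow> \<exists>D. (h has_real_derivative D) (at t within {a..b}) \<and> D \<le> \<phi> t"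
    and int: "\<phi> integrable_on {a..b}"
  shows "h b - h a \<le> integral {a..b} \<phi>"
proof -
  obtain h' where h': "\<And>t. t \<in> {a..b} - N \<Longrightarrow> (h has_real_derivative h' t) (at t within {a..b}) \<and> h' t \<le> \<phi> t"
    using deriv by metis
  have "(h' has_integral (h b - h a)) {a..b}"
    using h' by (intro fundamental_theorem_of_calculus_abs_continuous[OF ac \<open>a \<le> b\<close> N])
      (auto simp: has_real_derivative_iff_has_vector_derivative)
  then have "((\<lambda>t. if t \<in> N then \<phi> t else h' t) has_integral (h b - h a)) {a..b}"
    by (rule has_integral_spike[OF N, rotated]) auto
  then show ?thesis
    by (rule has_integral_le[OF _ integrable_integral[OF int]]) (use h' in auto)
qed

text \<open>The common source of the closure properties: increments controlled by increments.\<close>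
lemma abs_continuous_on_dominated:
  assumes u: "abs_continuous_on a b u" and v: "abs_continuous_on a b v" and "C \<ge> 0"
    and le: "\<And>r s. \<lbrakk>a \<le> r; r \<le> s; s \<le> b\<rbrakk> \<Longrightarrow> norm (w s - w r) \<le> C * (norm (u s - u r) + norm (v s - v r))"
  shows "abs_continuous_on a b w"
  unfolding abs_continuous_on_def
proof (intro allI impI)
  fix e :: real assume "e > 0"
  define e1 where "e1 = e / (2 * (C + 1))"
  have e1: "e1 > 0"
    using \<open>e > 0\<close> \<open>C \<ge> 0\<close> by (simp add: e1_def)
  obtain d1 where d1: "d1 > 0" and D1: "\<And>D. \<lbrakk>finite D; \<And>r s. (r, s) \<in> D \<Longrightarrow> a \<le> r \<and> r \<le> s \<and> s \<le> b;
     pairwise (\<lambda>(r, s) (r', s'). {r<..<s} \<inter> {r'<..<s'} = {}) D; (\<Sum>(r, s)\<in>D. s - r) < d1\<rbrakk>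
     \<Longrightarrow> (\<Sum>(r, s)\<in>D. norm (u s - u r)) < e1"
    using abs_continuous_onD[OF u e1] by blast
  obtain d2 where d2: "d2 > 0" and D2: "\<And>D. \<lbrakk>finite D; \<And>r s. (r, s) \<in> D \<Longrightarrow> a \<le> r \<and> r \<le> s \<and> s \<le> b;
     pairwise (\<lambda>(r, s) (r', s'). {r<..<s} \<inter> {r'<..<s'} = {}) D; (\<Sum>(r, s)\<in>D. s - r) < d2\<rbrakk>
     \<Longrightarrow> (\<Sum>(r, s)\<in>D. norm (v s - v r)) < e1"
    using abs_continuous_onD[OF v e1] by blast
  show "\<exists>d>0. \<forall>D. finite D \<and> (\<forall>(r, s)\<in>D. a \<le> r \<and> r \<le> s \<and> s \<le> b) \<and>
        pairwise (\<lambda>(r, s) (r', s'). {r<..<s} \<inter> {r'<..<s'} = {}) D \<and>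
        (\<Sum>(r, s)\<in>D. s - r) < d \<longrightarrow> (\<Sum>(r, s)\<in>D. norm (w s - w r)) < e"
  proof (intro exI[of _ "min d1 d2"] conjI allI impI)
    show "min d1 d2 > 0"
      using d1 d2 by simp
    fix D assume D: "finite D \<and> (\<forall>(r, s)\<in>D. a \<le> r \<and> r \<le> s \<and> s \<le> b) \<and>
        pairwise (\<lambda>(r, s) (r', s'). {r<..<s} \<inter> {r'<..<s'} = {}) D \<and> (\<Sum>(r, s)\<in>D. s - r) < min d1 d2"
    then have ab: "\<And>r s. (r, s) \<in> D \<Longrightarrow> a \<le> r \<and> r \<le> s \<and> s \<le> b"
      by blast
    have u: "(\<Sum>(r, s)\<in>D. norm (u s - u r)) < e1"
      by (rule D1[OF _ ab]) (use D in \<open>auto simp del: greaterThanLessThan_iff\<close>)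
    have v: "(\<Sum>(r, s)\<in>D. norm (v s - v r)) < e1"
      by (rule D2[OF _ ab]) (use D in \<open>auto simp del: greaterThanLessThan_iff\<close>)
    have "(\<Sum>(r, s)\<in>D. norm (w s - w r)) \<le> (\<Sum>(r, s)\<in>D. C * (norm (u s - u r) + norm (v s - v r)))"
      by (rule sum_mono) (use ab le in auto)
    also have "\<dots> = C * ((\<Sum>(r, s)\<in>D. norm (u s - u r)) + (\<Sum>(r, s)\<in>D. norm (v s - v r)))"
      by (simp add: split_def sum.distrib flip: sum_distrib_left)
    also have "\<dots> \<le> C * (e1 + e1)"
      using u v \<open>C \<ge> 0\<close> by (intro mult_left_mono) auto
    also have "\<dots> < (C + 1) * (e1 + e1)"
      using e1 by simp
    also have "\<dots> = e"
    proof -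
      have "e1 * (2 * (C + 1)) = e"
        using \<open>C \<ge> 0\<close> by (simp add: e1_def)
      then show ?thesis
        by (simp add: algebra_simps)
    qed
    finally show "(\<Sum>(r, s)\<in>D. norm (w s - w r)) < e" .
  qed
qed

lemma abs_continuous_on_imp_continuous_on:
  assumes "abs_continuous_on a b u"
  shows "continuous_on {a..b} u"
  unfolding continuous_on_iff
proof (intro ballI allI impI)
  fix t e :: real assume t: "t \<in> {a..b}" and "e > 0"
  obtain d where d: "d > 0" and D: "\<And>D. \<lbrakk>finite D; \<And>r s. (r, s) \<in> D \<Longrightarrow> a \<le> r \<and> r \<le> s \<and> s \<le> b;
     pairwise (\<lambda>(r, s) (r', s'). {r<..<s} \<inter> {r'<..<s'} = {}) D; (\<Sum>(r, s)\<in>D. s - r) < d\<rbrakk>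
     \<Longrightarrow> (\<Sum>(r, s)\<in>D. norm (u s - u r)) < e"
    using abs_continuous_onD[OF assms \<open>e > 0\<close>] by blast
  show "\<exists>d>0. \<forall>s\<in>{a..b}. dist s t < d \<longrightarrow> dist (u s) (u t) < e"
  proof (intro exI[of _ d] conjI d ballI impI)
    fix s assume s: "s \<in> {a..b}" "dist s t < d"
    have "(\<Sum>(r, s)\<in>{(min s t, max s t)}. norm (u s - u r)) < e"
      by (rule D) (use s t in \<open>auto simp: dist_real_def\<close>)
    then show "dist (u s) (u t) < e"
      by (cases "s \<le> t") (auto simp: dist_norm norm_minus_commute)
  qed
qed

lemma abs_continuous_on_add:
  assumes "abs_continuous_on a b u" "abs_continuous_on a b v"
  shows "abs_continuous_on a b (\<lambda>t. u t + v t)"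
  by (rule abs_continuous_on_dominated[OF assms, of 1]) (simp_all add: norm_diff_triangle_ineq)

lemma abs_continuous_on_Pair:
  assumes "abs_continuous_on a b u" "abs_continuous_on a b v"
  shows "abs_continuous_on a b (\<lambda>t. (u t, v t))"
  by (rule abs_continuous_on_dominated[OF assms, of 1]) (simp_all add: norm_Pair_le)

lemma abs_continuous_on_bilinear:
  assumes bil: "bounded_bilinear pr" and u: "abs_continuous_on a b u" and v: "abs_continuous_on a b v"
  shows "abs_continuous_on a b (\<lambda>t. pr (u t) (v t))"
proof -
  interpret bounded_bilinear pr
    by (rule bil)
  have "bounded (u ` {a..b})" "bounded (v ` {a..b})"
    using u v abs_continuous_on_imp_continuous_on compact_continuous_image compact_imp_bounded
    by (metis compact_Icc)+
  then obtain Bu Bv where Bu: "\<And>t. t \<in> {a..b} \<Longrightarrow> norm (u t) \<le> Bu"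
    and Bv: "\<And>t. t \<in> {a..b} \<Longrightarrow> norm (v t) \<le> Bv"
    unfolding bounded_iff by blast
  obtain K where K: "K \<ge> 0" "\<And>x y. norm (pr x y) \<le> norm x * norm y * K"
    using nonneg_bounded by blast
  define C where "C = max 0 (max Bu Bv) * K"
  show ?thesis
  proof (rule abs_continuous_on_dominated[OF u v, of C])
    show "C \<ge> 0"
      using K by (simp add: C_def)
    fix r s assume rs: "a \<le> r" "r \<le> s" "s \<le> b"
    let ?B = "max 0 (max Bu Bv)"
    have "pr (u s) (v s) - pr (u r) (v r) = pr (u s - u r) (v s) + pr (u r) (v s - v r)"
      by (simp add: diff_left diff_right)
    then have "norm (pr (u s) (v s) - pr (u r) (v r))
      \<le> norm (u s - u r) * norm (v s) * K + norm (u r) * norm (v s - v r) * K"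
      using K(2) by (metis (no_types, lifting) add_mono norm_triangle_le)
    also have "\<dots> \<le> norm (u s - u r) * ?B * K + ?B * norm (v s - v r) * K"
      using Bu[of r] Bv[of s] rs K(1) by (intro add_mono mult_right_mono mult_left_mono) auto
    finally show "norm (pr (u s) (v s) - pr (u r) (v r)) \<le> C * (norm (u s - u r) + norm (v s - v r))"
      by (simp add: C_def algebra_simps)
  qed
qed

lemma abs_continuous_on_ident: "abs_continuous_on a b (\<lambda>t::real. t)"
  unfolding abs_continuous_on_def
proof (intro allI impI exI conjI)
  fix e :: real and D :: "(real \<times> real) set"
  assume D: "finite D \<and> (\<forall>(r, s)\<in>D. a \<le> r \<and> r \<le> s \<and> s \<le> b) \<and>
        pairwise (\<lambda>(r, s) (r', s'). {r<..<s} \<inter> {r'<..<s'} = {}) D \<and> (\<Sum>(r, s)\<in>D. s - r) < e"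
  have "(\<Sum>(r, s)\<in>D. norm (s - r)) = (\<Sum>(r, s)\<in>D. s - r)"
    by (rule sum.cong) (use D in auto)
  then show "(\<Sum>(r, s)\<in>D. norm (s - r)) < e"
    using D by simp
qed

lemma abs_continuous_on_C1:
  fixes u :: "real \<Rightarrow> 'a::real_normed_vector"
  assumes deriv: "\<And>t. t \<in> {a..b} \<Longrightarrow> (u has_vector_derivative u' t) (at t within {a..b})"
    and cont: "continuous_on {a..b} u'"
  shows "abs_continuous_on a b u"
proof -
  have "bounded (u' ` {a..b})"
    using compact_continuous_image[OF cont] compact_imp_bounded by blast
  then obtain B where B: "\<And>t. t \<in> {a..b} \<Longrightarrow> norm (u' t) \<le> B"
    unfolding bounded_iff by blast
  show ?thesis
  proof (rule abs_continuous_on_dominated[OF abs_continuous_on_ident abs_continuous_on_ident, of "max 0 B"])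
    fix r s assume rs: "a \<le> r" "r \<le> s" "s \<le> b"
    have "norm (u s - u r) \<le> max 0 B * norm (s - r)"
    proof (rule differentiable_bound[of "{a..b}" _ "\<lambda>t h. h *\<^sub>R u' t"])
      show "onorm (\<lambda>h. h *\<^sub>R u' t) \<le> max 0 B" if "t \<in> {a..b}" for t
        using B[OF that] by (intro onorm_le) (simp add: mult.commute mult_left_mono max.coboundedI2)
    qed (use rs deriv in \<open>auto simp: has_vector_derivative_def\<close>)
    also have "\<dots> \<le> max 0 B * (norm (s - r) + norm (s - r))"
      by (intro mult_left_mono) auto
    finally show "norm (u s - u r) \<le> max 0 B * (norm (s - r) + norm (s - r))" .
  qed simp
qed

section \<open>Calculus on half-lines\<close>

lemma integral_has_real_derivative_Ici:
  fixes h :: "real \<Rightarrow> real"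
  assumes cont: "continuous_on {a..} h" and "t \<ge> a"
  shows "((\<lambda>s. integral {a..s} h) has_real_derivative h t) (at t within {a..})"
proof -
  have "((\<lambda>s. integral {a..s} h) has_vector_derivative h t) (at t within {a..t + 1})"
    using \<open>t \<ge> a\<close> by (intro integral_has_vector_derivative continuous_on_subset[OF cont]) auto
  moreover have "at t within {a..t + 1} = at t within {a..}"
    using \<open>t \<ge> a\<close> by (intro at_within_nhd[of _ "{..<t + 1}"]) auto
  ultimately show ?thesis
    by (simp add: has_real_derivative_iff_has_vector_derivative)
qed
lemma nonneg_bounded_integral_imp_absolutely_integrable_Ici:
  fixes h :: "real \<Rightarrow> real"
  assumes cont: "continuous_on {a..} h" and nonneg: "\<And>t. t \<ge> a \<Longrightarrow> h t \<ge> 0"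
    and le: "\<And>T. T \<ge> a \<Longrightarrow> integral {a..T} h \<le> C"
  shows "h absolutely_integrable_on {a..}"
proof -
  have int: "h integrable_on {a..T}" for T
    by (intro integrable_continuous_real continuous_on_subset[OF cont]) auto
  define l where "l = (SUP T\<in>{a..}. integral {a..T} h)"
  have bdd: "bdd_above ((\<lambda>T. integral {a..T} h) ` {a..})"
    using le by (auto intro!: bdd_aboveI2)
  have mono: "integral {a..S} h \<le> integral {a..T} h" if "S \<le> T" for S T
    using that nonneg int by (intro integral_subset_le) auto
  have "((\<lambda>T. integral {a..T} h) \<longlongrightarrow> l) at_top"
  proof (rule increasing_tendsto)
    show "\<forall>\<^sub>F T in at_top. integral {a..T} h \<le> l"
      unfolding l_def using eventually_ge_at_top[of a]
      by eventually_elim (auto intro!: cSUP_upper bdd)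
    fix z assume "z < l"
    then obtain S where "S \<ge> a" "z < integral {a..S} h"
      unfolding l_def by (subst (asm) less_cSUP_iff) (use bdd in auto)
    then show "\<forall>\<^sub>F T in at_top. z < integral {a..T} h"
      using mono by (auto intro!: eventually_at_top_linorderI[of S] intro: less_le_trans)
  qed
  then have "(h has_integral l) {a..}"
    by (rule has_integral_to_inf[OF int]) (rule nonneg)
  then show ?thesis
    by (intro nonnegative_absolutely_integrable_1) (auto simp: nonneg integrable_on_def)
qed

section \<open>Gradients of convex functions\<close>

text \<open>
  The description operator defining the gradient is justified here: by the Riesz representation
  the derivative is the inner product with a vector, and that vector is unique.
\<close>
lemma GDERIV_gradient:
  fixes f :: "'a::euclidean_space \<Rightarrow> real"
  assumes "f differentiable at x"
  shows "GDERIV f x :> gradient f x"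
proof -
  obtain f' where f': "(f has_derivative f') (at x)"
    using assms unfolding differentiable_def by blast
  then have "linear f'"
    by (simp add: bounded_linear.linear has_derivative_bounded_linear)
  then have "f' = (\<lambda>h. h \<bullet> adjoint f' 1)"
    by (auto simp: adjoint_works)
  then have "GDERIV f x :> adjoint f' 1"
    using f' by (simp add: gderiv_def)
  moreover have "D = D'" if "GDERIV f x :> D" "GDERIV f x :> D'" for D D'
  proof -
    have "(\<lambda>h. h \<bullet> D) = (\<lambda>h. h \<bullet> D')"
      using that unfolding gderiv_def by (rule has_derivative_unique)
    then have "\<forall>h. h \<bullet> D = h \<bullet> D'"
      by metis
    then show ?thesis
      by (rule vector_eq_ldot[THEN iffD1])
  qed
  ultimately show ?thesis
    unfolding gradient_def by (metis theI)
qed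

lemma GDERIV_chain_within:
  assumes "GDERIV \<Phi> (z t) :> D" and "(z has_vector_derivative v) (at t within S)"
  shows "((\<lambda>s. \<Phi> (z s)) has_real_derivative D \<bullet> v) (at t within S)"
proof -
  have "((\<lambda>s. \<Phi> (z s)) has_derivative (\<lambda>h. (h *\<^sub>R v) \<bullet> D)) (at t within S)"
    using has_derivative_compose[OF assms(2)[unfolded has_vector_derivative_def] assms(1)[unfolded gderiv_def]] .
  then show ?thesis
    by (simp add: has_field_derivative_def inner_commute mult_commute_abs)
qed

text \<open>Restriction to the line through the two points reduces this to convexity of a real function.\<close>
lemma convex_on_gradient_inequality:
  assumes f: "convex_on UNIV f" and "GDERIV f x :> D"
  shows "f y \<ge> f x + D \<bullet> (y - x)"
proof -
  define \<phi> where "\<phi> = (\<lambda>s::real. f (x + s *\<^sub>R (y - x)))"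
  have "convex_on UNIV \<phi>"
  proof (rule convex_onI)
    fix t r s :: real assume "0 < t" "t < 1"
    have "x + ((1 - t) *\<^sub>R r + t *\<^sub>R s) *\<^sub>R (y - x)
       = (1 - t) *\<^sub>R (x + r *\<^sub>R (y - x)) + t *\<^sub>R (x + s *\<^sub>R (y - x))"
      by (simp add: algebra_simps)
    then show "\<phi> ((1 - t) *\<^sub>R r + t *\<^sub>R s) \<le> (1 - t) * \<phi> r + t * \<phi> s"
      unfolding \<phi>_def using convex_onD[OF f, of t] \<open>0 < t\<close> \<open>t < 1\<close> by simp
  qed simp
  moreover have "(\<phi> has_real_derivative D \<bullet> (y - x)) (at 0)"
    unfolding \<phi>_def
    by (rule GDERIV_chain_within) (use assms in \<open>auto intro!: derivative_eq_intros\<close>)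
  ultimately have "\<phi> 1 - \<phi> 0 \<ge> D \<bullet> (y - x) * (1 - 0)"
    by (intro convex_on_imp_above_tangent[of UNIV]) auto
  then show ?thesis
    by (simp add: \<phi>_def)
qed

section \<open>Decay of the damping coefficient\<close>

lemma increment_ge_if_deriv_ge:
  fixes h :: "real \<Rightarrow> real"
  assumes "\<And>t. t \<ge> t0 \<Longrightarrow> (h has_real_derivative h' t) (at t within {t0..})"
    and "t0 \<le> a" "a \<le> b" and "\<And>t. t \<in> {a..b} \<Longrightarrow> h' t \<ge> c"
  shows "h b - h a \<ge> c * (b - a)"
proof -
  have "(h' has_integral (h b - h a)) {a..b}"
  proof (rule fundamental_theorem_of_calculus[OF \<open>a \<le> b\<close>])
    fix t assume "t \<in> {a..b}"
    then show "(h has_vector_derivative h' t) (at t within {a..b})"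
      using assms(1)[of t] assms(2)
      by (auto simp: has_real_derivative_iff_has_vector_derivative intro: has_vector_derivative_within_subset)
  qed
  moreover have "((\<lambda>_. c) has_integral (b - a) *\<^sub>R c) {a..b}"
    using has_integral_const_real[of c a b] assms(3) by simp
  ultimately show ?thesis
    using has_integral_le[of "\<lambda>_. c" _ "{a..b}" h'] assms(4) by (simp add: mult.commute)
qed

lemma antimono_on_imp_deriv_nonpos:
  fixes h :: "real \<Rightarrow> real"
  assumes mono: "antimono_on {t0..} h" and "t \<ge> t0" and "(h has_real_derivative D) (at t within {t0..})"
  shows "D \<le> 0"
proof (rule tendsto_upperbound)
  show "((\<lambda>s. (h s - h t) / (s - t)) \<longlongrightarrow> D) (at t within {t0..})"
    using assms(3) by (simp add: has_field_derivative_iff)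
  have "(h s - h t) / (s - t) \<le> 0" if "s \<ge> t0" for s
    using monotone_onD[OF mono, of s t] monotone_onD[OF mono, of t s] that \<open>t \<ge> t0\<close>
    by (cases "s \<le> t") (auto simp: divide_simps)
  then show "\<forall>\<^sub>F s in at t within {t0..}. (h s - h t) / (s - t) \<le> 0"
    by (auto simp: eventually_at_filter)
  show "at t within {t0..} \<noteq> bot"
  proof
    assume "at t within {t0..} = bot"
    moreover have "at_right t \<le> at t within {t0..}"
      using \<open>t \<ge> t0\<close> by (intro at_le) auto
    ultimately show False
      using trivial_limit_at_right_real[of t] by (simp add: bot_unique)
  qed
qed

text \<open>
  The second-order condition on \<open>\<gamma>\<close> forces the Riccati inequality, i.e. \<open>1 / \<gamma>\<close> grows at least
  with slope \<open>\<beta>\<close>. Multiplication of the condition by \<open>\<gamma>' \<le> 0\<close> shows that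
  \<open>W = \<beta>\<^sup>2 \<gamma>\<^sup>4 - \<gamma>'\<^sup>2\<close> never decreases. If the inequality failed at some \<open>t\<close>, \<open>W\<close> would be
  bounded below by a positive constant after \<open>t\<close>, hence so would \<open>\<gamma>\<close> and then \<open>\<gamma>''\<close>; but then
  \<open>\<gamma>'\<close> would become positive.
\<close>
lemma damping_decay:
  fixes \<gamma> \<gamma>1 \<gamma>2 :: "real \<Rightarrow> real"
  assumes pos: "\<And>t. t \<ge> t0 \<Longrightarrow> \<gamma> t > 0"
    and d1: "\<And>t. t \<ge> t0 \<Longrightarrow> (\<gamma> has_real_derivative \<gamma>1 t) (at t within {t0..})"
    and d2: "\<And>t. t \<ge> t0 \<Longrightarrow> (\<gamma>1 has_real_derivative \<gamma>2 t) (at t within {t0..})"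
    and nonpos: "\<And>t. t \<ge> t0 \<Longrightarrow> \<gamma>1 t \<le> 0"
    and conv: "\<And>t. t \<ge> t0 \<Longrightarrow> \<gamma>2 t \<ge> 2 * \<beta>\<^sup>2 * \<gamma> t ^ 3"
    and "\<beta> > 0" and "t \<ge> t0"
  shows "\<gamma>1 t \<le> - \<beta> * (\<gamma> t)\<^sup>2"
proof (rule ccontr)
  assume neg: "\<not> \<gamma>1 t \<le> - \<beta> * (\<gamma> t)\<^sup>2"
  define W where "W = (\<lambda>s. \<beta>\<^sup>2 * \<gamma> s ^ 4 - (\<gamma>1 s)\<^sup>2)"
  define c where "c = root 4 (W t / \<beta>\<^sup>2)"
  have "(\<gamma>1 t)\<^sup>2 < (\<beta> * (\<gamma> t)\<^sup>2)\<^sup>2"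
    using neg nonpos[OF \<open>t \<ge> t0\<close>] power_strict_mono[of "- \<gamma>1 t" "\<beta> * (\<gamma> t)\<^sup>2" 2] by simp
  then have Wt: "W t > 0"
    by (simp add: W_def power_mult_distrib)
  have dW: "(W has_real_derivative - 2 * \<gamma>1 s * (\<gamma>2 s - 2 * \<beta>\<^sup>2 * \<gamma> s ^ 3)) (at s within {t0..})" if "s \<ge> t0" for s
    unfolding W_def by (rule derivative_eq_intros d1 d2 that refl)+ (simp add: algebra_simps)
  have W: "W s \<ge> W t" if "s \<ge> t" for s
  proof -
    have "W s - W t \<ge> 0 * (s - t)"
    proof (rule increment_ge_if_deriv_ge[OF dW \<open>t \<ge> t0\<close> that])
      fix r assume "r \<in> {t..s}"
      then have "\<gamma>1 r \<le> 0" "\<gamma>2 r - 2 * \<beta>\<^sup>2 * \<gamma> r ^ 3 \<ge> 0"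
        using nonpos[of r] conv[of r] \<open>t \<ge> t0\<close> by auto
      then show "- 2 * \<gamma>1 r * (\<gamma>2 r - 2 * \<beta>\<^sup>2 * \<gamma> r ^ 3) \<ge> 0"
        using mult_nonpos_nonneg[of "\<gamma>1 r" "\<gamma>2 r - 2 * \<beta>\<^sup>2 * \<gamma> r ^ 3"] by linarith
    qed
    then show ?thesis by simp
  qed
  have c: "c > 0"
    using Wt \<open>\<beta> > 0\<close> by (simp add: c_def)
  have \<gamma>c: "\<gamma> s \<ge> c" if "s \<ge> t" for s
  proof -
    have "W t \<le> \<beta>\<^sup>2 * \<gamma> s ^ 4"
      using W[OF that] zero_le_power2[of "\<gamma>1 s"] by (simp only: W_def)
    then have "W t / \<beta>\<^sup>2 \<le> \<gamma> s ^ 4"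
      using \<open>\<beta> > 0\<close> by (simp add: divide_simps mult.commute)
    then have "c \<le> root 4 (\<gamma> s ^ 4)"
      unfolding c_def by simp
    then show ?thesis
      using pos[of s] that \<open>t \<ge> t0\<close> by (simp add: real_root_power_cancel)
  qed
  define c2 where "c2 = 2 * \<beta>\<^sup>2 * c ^ 3"
  have c2: "c2 > 0"
    using c \<open>\<beta> > 0\<close> by (simp add: c2_def)
  \<comment> \<open>With slope at least \<open>c2\<close>, \<open>\<gamma>1\<close> has risen to 1 by this time.\<close>
  define T where "T = t + (1 - \<gamma>1 t) / c2"
  have T: "T \<ge> t"
    using c2 nonpos[OF \<open>t \<ge> t0\<close>] by (simp add: T_def)
  have "\<gamma>1 T - \<gamma>1 t \<ge> c2 * (T - t)"
  proof (rule increment_ge_if_deriv_ge[OF d2 \<open>t \<ge> t0\<close> T])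
    fix s assume s: "s \<in> {t..T}"
    have "c2 \<le> 2 * \<beta>\<^sup>2 * \<gamma> s ^ 3"
      unfolding c2_def using \<gamma>c[of s] s c by (intro mult_left_mono power_mono) auto
    then show "\<gamma>2 s \<ge> c2"
      using conv[of s] s \<open>t \<ge> t0\<close> by simp
  qed
  also have "c2 * (T - t) = 1 - \<gamma>1 t"
    using c2 by (simp add: T_def)
  finally have "\<gamma>1 T \<ge> 1"
    by simp
  then show False
    using nonpos[of T] T \<open>t \<ge> t0\<close> by simp
qed

section \<open>Lyapunov analysis of a damped flow with skew coupling\<close>

text \<open>
  The algebra of the Lyapunov computation. Here \<open>g, g1, g2\<close> stand for \<open>\<gamma>\<close> and its derivatives, and
  \<open>a, b, c\<close> for the inner products \<open>w \<bullet> w\<close>, \<open>w \<bullet> v\<close>, \<open>v \<bullet> v\<close> of displacement and velocity. The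
  choice of \<open>\<sigma>\<close> is the one for which the mixed term \<open>b\<close> disappears; the coefficient left in front
  of \<open>a\<close> then splits into two pieces that are nonpositive by the Riccati inequality and by the
  second-order condition on \<open>\<gamma>\<close>.
\<close>
lemma lyapunov_rate_identity:
  fixes a b c \<Phi> R Gw Gv e \<beta> \<beta>0 g g1 g2 \<sigma> \<sigma>' :: real
  assumes \<sigma>: "\<sigma> = \<beta>0 * (1 - \<beta>0 - 2 * \<beta>) * g\<^sup>2 - \<beta>0 * g1"
    and \<sigma>': "\<sigma>' = 2 * \<beta>0 * (1 - \<beta>0 - 2 * \<beta>) * g * g1 - \<beta>0 * g2"
  shows "2 * \<beta> * g * (\<Phi> + (\<beta>0\<^sup>2 * g\<^sup>2 * a + 2 * \<beta>0 * g * b + c) / 2 + \<sigma> / 2 * a)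
      + (Gv + (\<beta>0 * g1 * (\<beta>0 * g * a + b) + (\<beta>0 * g - g) * (\<beta>0 * g * b + c) - (\<beta>0 * g * Gw + Gv) + e)
      + (\<sigma>' / 2 * a + \<sigma> * b))
    = e - g * ((\<beta>0 - 2 * \<beta>) * \<Phi> + \<beta>0 * R + (1 - \<beta> - \<beta>0) * c) - \<beta>0 * g * (Gw - \<Phi> - R)
      + \<beta>0 * ((1 - 3 * \<beta>) * g * (g1 + \<beta> * g\<^sup>2) - (g2 - 2 * \<beta>\<^sup>2 * g ^ 3) / 2) * a"
  unfolding \<sigma> \<sigma>' by (simp add: field_simps power2_eq_square power3_eq_cube)

lemma has_real_derivative_inner_self:
  assumes "(u has_vector_derivative u') (at t within S)"
  shows "((\<lambda>s. u s \<bullet> u s) has_real_derivative 2 * (u t \<bullet> u')) (at t within S)"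
proof -
  have d: "(u has_derivative (\<lambda>h. h *\<^sub>R u')) (at t within S)"
    using assms by (simp add: has_vector_derivative_def)
  have "(\<lambda>h. u t \<bullet> h *\<^sub>R u' + h *\<^sub>R u' \<bullet> u t) = (*) (2 * (u t \<bullet> u'))"
    by (simp add: fun_eq_iff inner_commute)
  then show ?thesis
    unfolding has_field_derivative_def using has_derivative_inner[OF d d] by simp
qed

text \<open>
  Primal and dual variables are merged into one trajectory \<open>z\<close> with velocity \<open>v\<close> and reference
  point \<open>zs\<close>. The primal-dual coupling becomes the map \<open>M\<close>; its skewness, \<open>M u \<bullet> u = 0\<close>, says that
  the coupling does no work. \<open>\<Phi>\<close> is the Lagrangian gap with gradient \<open>G\<close>, \<open>R\<close> half
  the squared constraint residual, and \<open>P\<close> a primitive of the damping. The forcing \<open>\<epsilon>\<close> enters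
  through a scalar majorant \<open>\<eta>\<close>, in the application the sum of the norms of its two components.
\<close>
locale damped_skew_flow =
  fixes t0 \<beta> \<beta>0 :: real and \<gamma> \<gamma>1 \<gamma>2 P :: "real \<Rightarrow> real"
    and z v \<epsilon> :: "real \<Rightarrow> 'a::euclidean_space" and \<eta> :: "real \<Rightarrow> real" and zs :: 'a
    and \<Phi> R :: "'a \<Rightarrow> real" and G M :: "'a \<Rightarrow> 'a" and N :: "real set"
  assumes \<gamma>_pos: "t \<ge> t0 \<Longrightarrow> \<gamma> t > 0"
    and \<gamma>_deriv: "t \<ge> t0 \<Longrightarrow> (\<gamma> has_real_derivative \<gamma>1 t) (at t within {t0..})"
    and \<gamma>1_deriv: "t \<ge> t0 \<Longrightarrow> (\<gamma>1 has_real_derivative \<gamma>2 t) (at t within {t0..})"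
    and \<gamma>2_cont: "continuous_on {t0..} \<gamma>2"
    and \<gamma>1_nonpos: "t \<ge> t0 \<Longrightarrow> \<gamma>1 t \<le> 0"
    and \<gamma>2_ge: "t \<ge> t0 \<Longrightarrow> \<gamma>2 t \<ge> 2 * \<beta>\<^sup>2 * \<gamma> t ^ 3"
    and \<beta>: "0 < \<beta>" "\<beta> \<le> 1/3" and \<beta>0: "2 * \<beta> \<le> \<beta>0" "\<beta>0 \<le> 1 - \<beta>"
    and P_deriv: "t \<ge> t0 \<Longrightarrow> (P has_real_derivative \<gamma> t) (at t within {t0..})"
    and \<Phi>_deriv: "GDERIV \<Phi> u :> G u" and G_cont: "continuous_on UNIV G"
    and R_cont: "continuous_on UNIV R" and R_nonneg: "R u \<ge> 0" and R_le: "R u \<le> \<Phi> u"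
    and G_monotone: "G u \<bullet> (u - zs) \<ge> \<Phi> u + R u"
    and M_skew: "M u \<bullet> u = 0"
    and z_deriv: "t \<ge> t0 \<Longrightarrow> (z has_vector_derivative v t) (at t within {t0..})"
    and v_cont: "continuous_on {t0..} v"
    and v_ac: "T \<ge> t0 \<Longrightarrow> abs_continuous_on t0 T v"
    and N: "negligible N"
    and v_deriv: "\<lbrakk>t \<ge> t0; t \<notin> N\<rbrakk> \<Longrightarrow> (v has_vector_derivative
        - \<gamma> t *\<^sub>R v t - G (z t) - M (z t - zs + (1 / (\<beta>0 * \<gamma> t)) *\<^sub>R v t) + \<epsilon> t) (at t within {t0..})"
    and \<epsilon>_le: "norm (\<epsilon> t) \<le> \<eta> t"
    and \<eta>_int: "(\<lambda>t. exp (\<beta> * P t) * \<eta> t) absolutely_integrable_on {t0..}"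
begin

definition w :: "real \<Rightarrow> 'a" where "w t = z t - zs"

text \<open>
  Proportional to the extrapolated displacement \<open>w + \<delta> v\<close> to which the coupling is applied, since
  \<open>\<beta>0 \<gamma> = 1 / \<delta>\<close>; pairing the equation of motion with this vector makes the coupling term vanish.
\<close>
definition m :: "real \<Rightarrow> 'a" where "m t = (\<beta>0 * \<gamma> t) *\<^sub>R w t + v t"

definition \<sigma> :: "real \<Rightarrow> real" where "\<sigma> t = \<beta>0 * (1 - \<beta>0 - 2 * \<beta>) * (\<gamma> t)\<^sup>2 - \<beta>0 * \<gamma>1 t"

definition lyap :: "real \<Rightarrow> real" where
  "lyap t = exp (2 * \<beta> * P t) * (\<Phi> (z t) + (m t \<bullet> m t) / 2 + \<sigma> t / 2 * (w t \<bullet> w t))"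

text \<open>The guaranteed rate of decrease of the Lyapunov function in the absence of forcing.\<close>
definition diss :: "real \<Rightarrow> real" where
  "diss t = exp (2 * \<beta> * P t) *
     (\<gamma> t * ((\<beta>0 - 2 * \<beta>) * \<Phi> (z t) + \<beta>0 * R (z t) + (1 - \<beta> - \<beta>0) * (norm (v t))\<^sup>2))"

lemma \<gamma>1_le: "t \<ge> t0 \<Longrightarrow> \<gamma>1 t \<le> - \<beta> * (\<gamma> t)\<^sup>2"
  using damping_decay[OF \<gamma>_pos \<gamma>_deriv \<gamma>1_deriv \<gamma>1_nonpos \<gamma>2_ge \<beta>(1)] .

text \<open>
  The factor \<open>1 - \<beta>0 - 2 \<beta>\<close> in \<open>\<sigma>\<close> may be negative; the Riccati inequality raises it by \<open>\<beta>\<close>, and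
  the result is nonnegative because \<open>\<beta>0 \<le> 1 - \<beta>\<close>.
\<close>
lemma \<sigma>_ge:
  assumes "t \<ge> t0"
  shows "\<sigma> t \<ge> \<beta>0 * (1 - \<beta>0 - \<beta>) * (\<gamma> t)\<^sup>2" and "\<sigma> t \<ge> 0"
proof -
  have "\<beta>0 * (- \<gamma>1 t) \<ge> \<beta>0 * (\<beta> * (\<gamma> t)\<^sup>2)"
    using \<gamma>1_le[OF assms] \<beta> \<beta>0 by (intro mult_left_mono) auto
  then show 1: "\<sigma> t \<ge> \<beta>0 * (1 - \<beta>0 - \<beta>) * (\<gamma> t)\<^sup>2"
    by (simp add: \<sigma>_def algebra_simps)
  have "\<beta>0 * (1 - \<beta>0 - \<beta>) * (\<gamma> t)\<^sup>2 \<ge> 0"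
    using \<beta> \<beta>0 by simp
  with 1 show "\<sigma> t \<ge> 0"
    by linarith
qed

lemma \<eta>_nonneg: "\<eta> t \<ge> 0"
  using \<epsilon>_le[of t] norm_ge_zero[of "\<epsilon> t"] by linarith

lemma \<Phi>_nonneg: "\<Phi> u \<ge> 0"
  using R_nonneg[of u] R_le[of u] by linarith

lemma lyap_ge:
  assumes "t \<ge> t0"
  shows "exp (2 * \<beta> * P t) * \<Phi> (z t) \<le> lyap t"
    and "exp (2 * \<beta> * P t) * (norm (m t))\<^sup>2 / 2 \<le> lyap t"
    and "exp (2 * \<beta> * P t) * (\<sigma> t * (norm (w t))\<^sup>2 / 2) \<le> lyap t"
    and "0 \<le> lyap t"
proof -
  have nonneg: "\<Phi> (z t) \<ge> 0" "(norm (m t))\<^sup>2 \<ge> 0" "\<sigma> t * (norm (w t))\<^sup>2 \<ge> 0"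
    using \<Phi>_nonneg \<sigma>_ge(2)[OF assms] by auto
  have lyap: "lyap t = exp (2 * \<beta> * P t) * (\<Phi> (z t) + (norm (m t))\<^sup>2 / 2 + \<sigma> t * (norm (w t))\<^sup>2 / 2)"
    by (simp add: lyap_def power2_norm_eq_inner)
  show "exp (2 * \<beta> * P t) * \<Phi> (z t) \<le> lyap t"
      "exp (2 * \<beta> * P t) * (\<sigma> t * (norm (w t))\<^sup>2 / 2) \<le> lyap t"
      "0 \<le> lyap t"
    unfolding lyap using nonneg by (auto intro!: mult_left_mono)
  show "exp (2 * \<beta> * P t) * (norm (m t))\<^sup>2 / 2 \<le> lyap t"
    unfolding lyap times_divide_eq_right[symmetric] using nonneg by (intro mult_left_mono) auto
qed

lemma diss_ge:
  assumes "t \<ge> t0"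
  shows "exp (2 * \<beta> * P t) * (\<gamma> t * ((\<beta>0 - 2 * \<beta>) * \<Phi> (z t))) \<le> diss t"
    and "exp (2 * \<beta> * P t) * (\<gamma> t * (\<beta>0 * R (z t))) \<le> diss t"
    and "exp (2 * \<beta> * P t) * (\<gamma> t * ((1 - \<beta> - \<beta>0) * (norm (v t))\<^sup>2)) \<le> diss t"
proof -
  have "(\<beta>0 - 2 * \<beta>) * \<Phi> (z t) \<ge> 0" "\<beta>0 * R (z t) \<ge> 0" "(1 - \<beta> - \<beta>0) * (norm (v t))\<^sup>2 \<ge> 0"
    using \<Phi>_nonneg R_nonneg \<beta> \<beta>0 by auto
  then show "exp (2 * \<beta> * P t) * (\<gamma> t * ((\<beta>0 - 2 * \<beta>) * \<Phi> (z t))) \<le> diss t"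
    "exp (2 * \<beta> * P t) * (\<gamma> t * (\<beta>0 * R (z t))) \<le> diss t"
    "exp (2 * \<beta> * P t) * (\<gamma> t * ((1 - \<beta> - \<beta>0) * (norm (v t))\<^sup>2)) \<le> diss t"
    unfolding diss_def using \<gamma>_pos[OF assms] by (auto intro!: mult_left_mono)
qed

lemma weight_square: "exp (2 * \<beta> * P t) = (exp (\<beta> * P t))\<^sup>2"
  using exp_double[of "\<beta> * P t"] by (simp add: mult.assoc)

text \<open>
  The coupling is orthogonal to \<open>m\<close>, the gradient terms cancel except for \<open>- \<beta>0 \<gamma> (G \<bullet> w)\<close>, which
  convexity turns into dissipation, and the forcing is absorbed by Cauchy-Schwarz because
  \<open>m\<close> is itself controlled by the Lyapunov function.
\<close>
lemma lyap_deriv: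
  assumes t: "t \<ge> t0" "t \<notin> N"
  shows "\<exists>D. (lyap has_real_derivative D) (at t within {t0..}) \<and>
      D \<le> exp (\<beta> * P t) * \<eta> t * sqrt (2 * lyap t) - diss t"
proof -
  let ?F = "at t within {t0..}"
  define u where "u = w t + (1 / (\<beta>0 * \<gamma> t)) *\<^sub>R v t"
  define v' where "v' = - \<gamma> t *\<^sub>R v t - G (z t) - M u + \<epsilon> t"
  define m' where "m' = (\<beta>0 * \<gamma> t) *\<^sub>R v t + (\<beta>0 * \<gamma>1 t) *\<^sub>R w t + v'"
  define \<sigma>' where "\<sigma>' = 2 * \<beta>0 * (1 - \<beta>0 - 2 * \<beta>) * \<gamma> t * \<gamma>1 t - \<beta>0 * \<gamma>2 t"
  have "\<beta>0 > 0" "\<gamma> t > 0"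
    using \<beta> \<beta>0 \<gamma>_pos[OF t(1)] by auto
  have dw: "(w has_vector_derivative v t) ?F"
    unfolding w_def[abs_def] using z_deriv[OF t(1)] by (auto intro!: derivative_eq_intros)
  have dv: "(v has_vector_derivative v') ?F"
    using v_deriv[OF t] by (simp add: v'_def u_def w_def)
  have dm: "(m has_vector_derivative m') ?F"
  proof -
    have "((\<lambda>s. \<beta>0 * \<gamma> s) has_real_derivative \<beta>0 * \<gamma>1 t) ?F"
      using \<gamma>_deriv[OF t(1)] by (rule DERIV_cmult)
    from has_vector_derivative_add[OF has_vector_derivative_scaleR[OF this dw] dv]
    show ?thesis
      unfolding m_def[abs_def] m'_def .
  qed
  have d\<sigma>: "(\<sigma> has_real_derivative \<sigma>') ?F"
    unfolding \<sigma>_def[abs_def] \<sigma>'_def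
    by (rule derivative_eq_intros \<gamma>_deriv[OF t(1)] \<gamma>1_deriv[OF t(1)] refl)+ (simp add: algebra_simps)
  have d\<Phi>: "((\<lambda>s. \<Phi> (z s)) has_real_derivative G (z t) \<bullet> v t) ?F"
    by (rule GDERIV_chain_within[OF \<Phi>_deriv z_deriv[OF t(1)]])
  have dP: "((\<lambda>s. exp (2 * \<beta> * P s)) has_real_derivative exp (2 * \<beta> * P t) * (2 * \<beta> * \<gamma> t)) ?F"
    by (rule derivative_eq_intros P_deriv[OF t(1)] refl)+ simp
  define S where "S = \<Phi> (z t) + (m t \<bullet> m t) / 2 + \<sigma> t / 2 * (w t \<bullet> w t)"
  define S' where "S' = G (z t) \<bullet> v t + m t \<bullet> m' + (\<sigma>' / 2 * (w t \<bullet> w t) + \<sigma> t * (w t \<bullet> v t))"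
  have dS: "((\<lambda>s. \<Phi> (z s) + (m s \<bullet> m s) / 2 + \<sigma> s / 2 * (w s \<bullet> w s)) has_real_derivative S') ?F"
    unfolding S'_def
    by (rule DERIV_cong[OF DERIV_add[OF DERIV_add[OF d\<Phi> DERIV_cdivide[OF has_real_derivative_inner_self[OF dm]]]
          DERIV_mult[OF DERIV_cdivide[OF d\<sigma>] has_real_derivative_inner_self[OF dw]]]]) simp
  have "(lyap has_real_derivative exp (2 * \<beta> * P t) * (2 * \<beta> * \<gamma> t) * S + S' * exp (2 * \<beta> * P t)) ?F"
    unfolding lyap_def[abs_def] S_def by (rule DERIV_mult[OF dP dS])
  moreover have "exp (2 * \<beta> * P t) * (2 * \<beta> * \<gamma> t) * S + S' * exp (2 * \<beta> * P t)
     = exp (2 * \<beta> * P t) * (2 * \<beta> * \<gamma> t * S + S')"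
    by (simp add: algebra_simps)
  ultimately have dE: "(lyap has_real_derivative exp (2 * \<beta> * P t) * (2 * \<beta> * \<gamma> t * S + S')) ?F"
    by simp
  have skew: "m t \<bullet> M u = 0"
  proof -
    have "m t = (\<beta>0 * \<gamma> t) *\<^sub>R u"
      using \<open>\<beta>0 > 0\<close> \<open>\<gamma> t > 0\<close> by (simp add: m_def u_def algebra_simps)
    then show ?thesis
      using M_skew[of u] by (simp add: inner_commute)
  qed
  have mm: "m t \<bullet> m t = \<beta>0\<^sup>2 * (\<gamma> t)\<^sup>2 * (w t \<bullet> w t) + 2 * \<beta>0 * \<gamma> t * (w t \<bullet> v t) + v t \<bullet> v t"
    by (simp add: m_def inner_add_left inner_add_right inner_commute[of "v t" "w t"] power2_eq_square algebra_simps)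
  have mw: "m t \<bullet> w t = \<beta>0 * \<gamma> t * (w t \<bullet> w t) + w t \<bullet> v t"
    by (simp add: m_def inner_add_left inner_commute[of "v t" "w t"])
  have mv: "m t \<bullet> v t = \<beta>0 * \<gamma> t * (w t \<bullet> v t) + v t \<bullet> v t"
    by (simp add: m_def inner_add_left)
  have mG: "m t \<bullet> G (z t) = \<beta>0 * \<gamma> t * (G (z t) \<bullet> w t) + G (z t) \<bullet> v t"
    by (simp add: m_def inner_add_left inner_commute[of "w t" "G (z t)"] inner_commute[of "v t" "G (z t)"])
  have "m t \<bullet> m' = \<beta>0 * \<gamma>1 t * (m t \<bullet> w t) + (\<beta>0 * \<gamma> t - \<gamma> t) * (m t \<bullet> v t) - m t \<bullet> G (z t) - m t \<bullet> M u + m t \<bullet> \<epsilon> t"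
    by (simp add: m'_def v'_def inner_add_right inner_diff_right algebra_simps)
  then have mm': "m t \<bullet> m' = \<beta>0 * \<gamma>1 t * (\<beta>0 * \<gamma> t * (w t \<bullet> w t) + w t \<bullet> v t)
      + (\<beta>0 * \<gamma> t - \<gamma> t) * (\<beta>0 * \<gamma> t * (w t \<bullet> v t) + v t \<bullet> v t)
      - (\<beta>0 * \<gamma> t * (G (z t) \<bullet> w t) + G (z t) \<bullet> v t) + m t \<bullet> \<epsilon> t"
    by (simp add: mw mv mG skew)
  define rate where "rate = \<gamma> t * ((\<beta>0 - 2 * \<beta>) * \<Phi> (z t) + \<beta>0 * R (z t) + (1 - \<beta> - \<beta>0) * (v t \<bullet> v t))"
  have eq: "2 * \<beta> * \<gamma> t * S + S' = m t \<bullet> \<epsilon> t - rate - \<beta>0 * \<gamma> t * (G (z t) \<bullet> w t - \<Phi> (z t) - R (z t))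
      + \<beta>0 * ((1 - 3 * \<beta>) * \<gamma> t * (\<gamma>1 t + \<beta> * (\<gamma> t)\<^sup>2) - (\<gamma>2 t - 2 * \<beta>\<^sup>2 * \<gamma> t ^ 3) / 2) * (w t \<bullet> w t)"
    unfolding S_def S'_def mm mm' rate_def
    by (rule lyapunov_rate_identity) (simp_all add: \<sigma>_def \<sigma>'_def)
  have "\<beta>0 * \<gamma> t * (G (z t) \<bullet> w t - \<Phi> (z t) - R (z t)) \<ge> 0"
    using G_monotone[of "z t"] \<open>\<beta>0 > 0\<close> \<open>\<gamma> t > 0\<close> by (intro mult_nonneg_nonneg) (auto simp: w_def)
  moreover have "\<beta>0 * ((1 - 3 * \<beta>) * \<gamma> t * (\<gamma>1 t + \<beta> * (\<gamma> t)\<^sup>2) - (\<gamma>2 t - 2 * \<beta>\<^sup>2 * \<gamma> t ^ 3) / 2) * (w t \<bullet> w t) \<le> 0"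
  proof -
    have "(1 - 3 * \<beta>) * \<gamma> t * (\<gamma>1 t + \<beta> * (\<gamma> t)\<^sup>2) \<le> 0"
      using \<beta> \<gamma>1_le[OF t(1)] \<open>\<gamma> t > 0\<close> by (intro mult_nonneg_nonpos) auto
    then have "(1 - 3 * \<beta>) * \<gamma> t * (\<gamma>1 t + \<beta> * (\<gamma> t)\<^sup>2) - (\<gamma>2 t - 2 * \<beta>\<^sup>2 * \<gamma> t ^ 3) / 2 \<le> 0"
      using \<gamma>2_ge[OF t(1)] by simp
    then show ?thesis
      using \<open>\<beta>0 > 0\<close> by (intro mult_nonpos_nonneg mult_nonneg_nonpos) auto
  qed
  ultimately have "2 * \<beta> * \<gamma> t * S + S' \<le> m t \<bullet> \<epsilon> t - rate"
    unfolding eq by linarith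
  then have "exp (2 * \<beta> * P t) * (2 * \<beta> * \<gamma> t * S + S') \<le> exp (2 * \<beta> * P t) * (m t \<bullet> \<epsilon> t - rate)"
    by (intro mult_left_mono) auto
  also have "\<dots> = exp (2 * \<beta> * P t) * (m t \<bullet> \<epsilon> t) - diss t"
    by (simp add: diss_def rate_def right_diff_distrib power2_norm_eq_inner)
  also have "exp (2 * \<beta> * P t) * (m t \<bullet> \<epsilon> t) \<le> exp (\<beta> * P t) * \<eta> t * sqrt (2 * lyap t)"
  proof -
    have "(exp (\<beta> * P t) * norm (m t))\<^sup>2 \<le> 2 * lyap t"
      using lyap_ge(2)[OF t(1)] by (simp add: power_mult_distrib weight_square)
    then have *: "exp (\<beta> * P t) * norm (m t) \<le> sqrt (2 * lyap t)"
      by (rule real_le_rsqrt)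
    have "m t \<bullet> \<epsilon> t \<le> norm (m t) * \<eta> t"
      using norm_cauchy_schwarz[of "m t" "\<epsilon> t"] mult_left_mono[OF \<epsilon>_le[of t], of "norm (m t)"] by simp
    then have "exp (2 * \<beta> * P t) * (m t \<bullet> \<epsilon> t) \<le> exp (2 * \<beta> * P t) * (norm (m t) * \<eta> t)"
      by (intro mult_left_mono) auto
    also have "\<dots> = exp (\<beta> * P t) * \<eta> t * (exp (\<beta> * P t) * norm (m t))"
      by (simp add: weight_square power2_eq_square)
    also have "\<dots> \<le> exp (\<beta> * P t) * \<eta> t * sqrt (2 * lyap t)"
      by (intro mult_left_mono * mult_nonneg_nonneg \<eta>_nonneg) auto
    finally show ?thesis .
  qed
  finally show ?thesis
    using dE by auto
qed

lemma continuity: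
  "continuous_on {t0..} \<gamma>" "continuous_on {t0..} \<gamma>1" "continuous_on {t0..} P" "continuous_on {t0..} z"
  "continuous_on {t0..} (\<lambda>t. \<Phi> (z t))" "continuous_on {t0..} (\<lambda>t. R (z t))"
proof -
  show "continuous_on {t0..} \<gamma>"
    by (rule DERIV_continuous_on) (rule \<gamma>_deriv, simp)
  show "continuous_on {t0..} \<gamma>1"
    by (rule DERIV_continuous_on) (rule \<gamma>1_deriv, simp)
  show "continuous_on {t0..} P"
    by (rule DERIV_continuous_on) (rule P_deriv, simp)
  show z: "continuous_on {t0..} z"
    unfolding continuous_on_eq_continuous_within
    by (intro ballI has_vector_derivative_continuous[OF z_deriv]) simp
  show "continuous_on {t0..} (\<lambda>t. R (z t))"
    by (rule continuous_on_compose2[OF R_cont z]) simp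
  show "continuous_on {t0..} (\<lambda>t. \<Phi> (z t))"
    by (rule DERIV_continuous_on) (rule GDERIV_chain_within[OF \<Phi>_deriv z_deriv], simp)
qed

text \<open>
  The trajectory is twice differentiable only almost everywhere, so a differential inequality for
  the Lyapunov function may be integrated only because of its absolute continuity.
\<close>
lemma lyap_abs_continuous:
  assumes "T \<ge> t0"
  shows "abs_continuous_on t0 T lyap"
proof -
  have T: "{t0..T} \<subseteq> {t0..}"
    by auto
  note c = continuity(1-4)[THEN continuous_on_subset, OF T] continuous_on_subset[OF \<gamma>2_cont T]
     continuous_on_subset[OF v_cont T]
  have sub: "(f has_vector_derivative f') (at t within {t0..T})" if "(f has_vector_derivative f') (at t within {t0..})" for f f' t
    using that by (rule has_vector_derivative_within_subset) auto
  note v = v_ac[OF assms]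
  have \<gamma>: "abs_continuous_on t0 T \<gamma>" and \<gamma>1: "abs_continuous_on t0 T \<gamma>1"
    using abs_continuous_on_C1[OF sub c(2), of \<gamma>] abs_continuous_on_C1[OF sub c(5), of \<gamma>1] \<gamma>_deriv \<gamma>1_deriv
    by (auto simp: has_real_derivative_iff_has_vector_derivative)
  have w: "abs_continuous_on t0 T w"
    by (rule abs_continuous_on_C1[OF sub c(6)])
      (use z_deriv in \<open>auto simp: w_def[abs_def] intro!: derivative_eq_intros\<close>)
  have \<Phi>: "abs_continuous_on t0 T (\<lambda>t. \<Phi> (z t))"
  proof (rule abs_continuous_on_C1)
    show "((\<lambda>t. \<Phi> (z t)) has_vector_derivative G (z t) \<bullet> v t) (at t within {t0..T})" if "t \<in> {t0..T}" for t
      using GDERIV_chain_within[OF \<Phi>_deriv z_deriv] that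
      by (auto simp: has_real_derivative_iff_has_vector_derivative intro!: sub)
    show "continuous_on {t0..T} (\<lambda>t. G (z t) \<bullet> v t)"
      by (intro continuous_intros continuous_on_compose2[OF G_cont c(4)] c(6)) simp
  qed
  have P: "abs_continuous_on t0 T (\<lambda>t. exp (2 * \<beta> * P t))"
  proof (rule abs_continuous_on_C1)
    show "((\<lambda>t. exp (2 * \<beta> * P t)) has_vector_derivative exp (2 * \<beta> * P t) * (2 * \<beta> * \<gamma> t)) (at t within {t0..T})"
      if "t \<in> {t0..T}" for t
      using that P_deriv[of t]
      by (auto simp flip: has_real_derivative_iff_has_vector_derivative intro!: derivative_eq_intros intro: DERIV_subset)
    show "continuous_on {t0..T} (\<lambda>t. exp (2 * \<beta> * P t) * (2 * \<beta> * \<gamma> t))"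
      by (intro continuous_intros c)
  qed
  have const: "abs_continuous_on t0 T (\<lambda>_. k)" for k :: real
    by (rule abs_continuous_on_C1[of _ _ _ "\<lambda>_. 0"]) auto
  note mult = abs_continuous_on_bilinear[OF bounded_bilinear_mult]
  note inner = abs_continuous_on_bilinear[OF bounded_bilinear_inner]
  have m: "abs_continuous_on t0 T m"
    unfolding m_def[abs_def]
    by (intro abs_continuous_on_add v abs_continuous_on_bilinear[OF bounded_bilinear_scaleR] mult const \<gamma> w)
  have "abs_continuous_on t0 T (\<lambda>t. exp (2 * \<beta> * P t) * (\<Phi> (z t) + m t \<bullet> m t * (1/2)
      + (\<beta>0 * (1 - \<beta>0 - 2 * \<beta>) * (\<gamma> t * \<gamma> t) + (- \<beta>0) * \<gamma>1 t) * (1/2) * (w t \<bullet> w t)))"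
    by (intro abs_continuous_on_add mult inner m w P \<Phi> \<gamma> \<gamma>1 const)
  then show ?thesis
    by (simp add: lyap_def[abs_def] \<sigma>_def power2_eq_square)
qed

definition total_forcing :: real where "total_forcing = integral {t0..} (\<lambda>t. exp (\<beta> * P t) * \<eta> t)"

lemma diss_cont: "continuous_on {t0..} diss"
  unfolding diss_def[abs_def] by (intro continuous_intros continuity v_cont)

lemma lyap_growth:
  assumes "T \<ge> t0" and max: "\<And>t. t \<in> {t0..T} \<Longrightarrow> lyap t \<le> K"
  shows "lyap T + integral {t0..T} diss \<le> lyap t0 + sqrt (2 * K) * total_forcing"
proof -
  let ?h = "\<lambda>t. exp (\<beta> * P t) * \<eta> t"
  have h: "?h integrable_on {t0..}" "?h integrable_on {t0..T}"
  proof -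
    show h: "?h integrable_on {t0..}"
      by (rule set_lebesgue_integral_eq_integral(1)[OF \<eta>_int])
    show "?h integrable_on {t0..T}"
      by (rule integrable_on_subinterval[OF h]) auto
  qed
  have diss: "diss integrable_on {t0..T}"
    by (intro integrable_continuous_real continuous_on_subset[OF diss_cont]) auto
  have K: "sqrt (2 * K) \<ge> 0"
    using lyap_ge(4)[of t0] max[of t0] \<open>T \<ge> t0\<close> by auto
  have "lyap T - lyap t0 \<le> integral {t0..T} (\<lambda>t. sqrt (2 * K) * ?h t - diss t)"
  proof (rule abs_continuous_increment_le[OF lyap_abs_continuous[OF \<open>T \<ge> t0\<close>] \<open>T \<ge> t0\<close> N])
    fix t assume t: "t \<in> {t0..T} - N"
    then obtain D where D: "(lyap has_real_derivative D) (at t within {t0..})"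
        "D \<le> ?h t * sqrt (2 * lyap t) - diss t"
      using lyap_deriv[of t] by auto
    have "?h t * sqrt (2 * lyap t) \<le> ?h t * sqrt (2 * K)"
      using max[of t] t by (intro mult_left_mono mult_nonneg_nonneg \<eta>_nonneg) auto
    then have "D \<le> sqrt (2 * K) * ?h t - diss t"
      using D(2) by (simp add: mult.commute)
    moreover have "(lyap has_real_derivative D) (at t within {t0..T})"
      using D(1) by (rule DERIV_subset) auto
    ultimately show "\<exists>D. (lyap has_real_derivative D) (at t within {t0..T}) \<and> D \<le> sqrt (2 * K) * ?h t - diss t"
      by blast
  qed (intro integrable_diff integrable_on_mult_right h diss)
  also have "\<dots> = sqrt (2 * K) * integral {t0..T} ?h - integral {t0..T} diss"
    using integral_diff[OF integrable_on_mult_right[OF h(2), of "sqrt (2 * K)"] diss] by simp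
  also have "integral {t0..T} ?h \<le> total_forcing"
    unfolding total_forcing_def using h \<eta>_nonneg by (intro integral_subset_le) auto
  finally show ?thesis
    using K by (simp add: mult_left_mono)
qed

text \<open>
  A Gronwall argument: at a maximum point \<open>s\<close> of the Lyapunov function \<open>E\<close> on \<open>[t0, t]\<close>, with \<open>C\<close>
  the total forcing, the growth estimate reads \<open>E s \<le> E t0 + C sqrt (2 E s)\<close>, and
  \<open>C sqrt (2 E s) \<le> C\<^sup>2 + E s / 2\<close> absorbs half of the left-hand side.
\<close>
lemma lyap_bounded:
  assumes "t \<ge> t0"
  shows "lyap t \<le> 2 * lyap t0 + 2 * total_forcing\<^sup>2"
proof -
  have "continuous_on {t0..t} lyap"
    by (intro abs_continuous_on_imp_continuous_on lyap_abs_continuous assms)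
  then obtain s where s: "s \<in> {t0..t}" and max: "\<And>r. r \<in> {t0..t} \<Longrightarrow> lyap r \<le> lyap s"
    using continuous_attains_sup[of "{t0..t}" lyap] assms by auto
  have "lyap s + integral {t0..s} diss \<le> lyap t0 + sqrt (2 * lyap s) * total_forcing"
    using s by (intro lyap_growth max) auto
  moreover have "integral {t0..s} diss \<ge> 0"
  proof (rule integral_nonneg)
    show "diss integrable_on {t0..s}"
      by (intro integrable_continuous_real continuous_on_subset[OF diss_cont]) auto
    show "diss r \<ge> 0" if "r \<in> {t0..s}" for r
    proof -
      have "exp (2 * \<beta> * P r) * (\<gamma> r * (\<beta>0 * R (z r))) \<ge> 0"
        using that \<gamma>_pos[of r] R_nonneg[of "z r"] \<beta> \<beta>0 by simp
      then show ?thesis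
        using diss_ge(2)[of r] that by simp
    qed
  qed
  moreover have "sqrt (2 * lyap s) * total_forcing \<le> total_forcing\<^sup>2 + lyap s / 2"
  proof -
    have "(sqrt (2 * lyap s))\<^sup>2 = 2 * lyap s"
      using lyap_ge(4)[of s] s by simp
    moreover have "(total_forcing - sqrt (2 * lyap s) / 2)\<^sup>2 \<ge> 0"
      by simp
    ultimately show ?thesis
      by (simp add: power2_diff power_divide algebra_simps)
  qed
  ultimately have "lyap s \<le> 2 * lyap t0 + 2 * total_forcing\<^sup>2"
    by linarith
  then show ?thesis
    using max[of t] assms by simp
qed

lemma integrable_if_le_diss:
  assumes "c > 0" and h: "continuous_on {t0..} h" "\<And>t. t \<ge> t0 \<Longrightarrow> 0 \<le> h t"
    and le: "\<And>t. t \<ge> t0 \<Longrightarrow> c * h t \<le> diss t"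
  shows "h absolutely_integrable_on {t0..}"
proof (rule nonneg_bounded_integral_imp_absolutely_integrable_Ici[OF h])
  fix T assume "T \<ge> t0"
  define K where "K = 2 * lyap t0 + 2 * total_forcing\<^sup>2"
  have int: "f integrable_on {t0..T}" if "continuous_on {t0..} f" for f :: "real \<Rightarrow> real"
    by (intro integrable_continuous_real continuous_on_subset[OF that]) auto
  have "c * integral {t0..T} h = integral {t0..T} (\<lambda>t. c * h t)"
    by simp
  also have "\<dots> \<le> integral {t0..T} diss"
    using le int[OF diss_cont] int[OF continuous_on_mult_left[OF h(1)], of c] by (intro integral_le) auto
  also have "\<dots> \<le> lyap t0 + sqrt (2 * K) * total_forcing"
    using lyap_growth[OF \<open>T \<ge> t0\<close>, of K] lyap_bounded lyap_ge(4)[OF \<open>T \<ge> t0\<close>] by (simp add: K_def)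
  finally show "integral {t0..T} h \<le> (lyap t0 + sqrt (2 * K) * total_forcing) / c"
    using \<open>c > 0\<close> by (simp add: field_simps)
qed

lemma potential_decay: "\<exists>K. \<forall>t\<ge>t0. \<Phi> (z t) \<le> K * exp (- 2 * \<beta> * P t)"
proof (intro exI allI impI)
  fix t assume "t \<ge> t0"
  have "exp (2 * \<beta> * P t) * \<Phi> (z t) \<le> 2 * lyap t0 + 2 * total_forcing\<^sup>2"
    using lyap_ge(1)[OF \<open>t \<ge> t0\<close>] lyap_bounded[OF \<open>t \<ge> t0\<close>] by linarith
  then show "\<Phi> (z t) \<le> (2 * lyap t0 + 2 * total_forcing\<^sup>2) * exp (- 2 * \<beta> * P t)"
    by (simp add: exp_minus field_simps)
qed

lemma residual_integrable: "(\<lambda>t. exp (2 * \<beta> * P t) * \<gamma> t * R (z t)) absolutely_integrable_on {t0..}"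
proof (rule integrable_if_le_diss[of \<beta>0])
  fix t assume t: "t \<ge> t0"
  show "0 \<le> exp (2 * \<beta> * P t) * \<gamma> t * R (z t)"
    using \<gamma>_pos[OF t] R_nonneg by simp
  show "\<beta>0 * (exp (2 * \<beta> * P t) * \<gamma> t * R (z t)) \<le> diss t"
    using diss_ge(2)[OF t] by (simp only: mult_ac)
qed (use \<beta> \<beta>0 in simp, intro continuous_intros continuity v_cont)

lemma potential_integrable:
  assumes "2 * \<beta> < \<beta>0"
  shows "(\<lambda>t. exp (2 * \<beta> * P t) * \<gamma> t * \<Phi> (z t)) absolutely_integrable_on {t0..}"
proof (rule integrable_if_le_diss[of "\<beta>0 - 2 * \<beta>"])
  fix t assume t: "t \<ge> t0"
  show "0 \<le> exp (2 * \<beta> * P t) * \<gamma> t * \<Phi> (z t)"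
    using \<gamma>_pos[OF t] \<Phi>_nonneg by simp
  show "(\<beta>0 - 2 * \<beta>) * (exp (2 * \<beta> * P t) * \<gamma> t * \<Phi> (z t)) \<le> diss t"
    using diss_ge(1)[OF t] by (simp only: mult_ac)
qed (use assms in simp, intro continuous_intros continuity v_cont)

lemma velocity_integrable:
  assumes "\<beta>0 < 1 - \<beta>"
  shows "(\<lambda>t. exp (2 * \<beta> * P t) * \<gamma> t * (norm (v t))\<^sup>2) absolutely_integrable_on {t0..}"
proof (rule integrable_if_le_diss[of "1 - \<beta> - \<beta>0"])
  fix t assume t: "t \<ge> t0"
  show "0 \<le> exp (2 * \<beta> * P t) * \<gamma> t * (norm (v t))\<^sup>2"
    using \<gamma>_pos[OF t] zero_le_power2 by simp
  show "(1 - \<beta> - \<beta>0) * (exp (2 * \<beta> * P t) * \<gamma> t * (norm (v t))\<^sup>2) \<le> diss t"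
    using diss_ge(3)[OF t] by (simp only: mult_ac)
qed (use assms in simp, intro continuous_intros continuity v_cont)

text \<open>
  With \<open>\<beta>0 < 1 - \<beta>\<close> strict, \<open>\<sigma>\<close> is bounded below by a positive multiple of \<open>\<gamma>\<^sup>2\<close>, so the
  Lyapunov function controls \<open>\<gamma> w\<close> besides \<open>m = \<beta>0 \<gamma> w + v\<close>, and hence \<open>v\<close>.
\<close>
lemma velocity_decay:
  assumes "\<beta>0 < 1 - \<beta>"
  shows "\<exists>K. \<forall>t\<ge>t0. norm (v t) \<le> K * exp (- \<beta> * P t)"
proof (intro exI allI impI)
  define B where "B = 2 * lyap t0 + 2 * total_forcing\<^sup>2"
  define k where "k = \<beta>0 * (1 - \<beta>0 - \<beta>)"
  have k: "k > 0" "\<beta>0 > 0"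
    using assms \<beta> \<beta>0 by (auto simp: k_def)
  fix t assume t: "t \<ge> t0"
  let ?q = "exp (\<beta> * P t)"
  have "(?q * norm (m t))\<^sup>2 \<le> 2 * B"
    using lyap_ge(2)[OF t] lyap_bounded[OF t] by (simp add: power_mult_distrib B_def weight_square)
  then have m: "?q * norm (m t) \<le> sqrt (2 * B)"
    by (rule real_le_rsqrt)
  have "k * (?q * (\<gamma> t * norm (w t)))\<^sup>2 = ?q\<^sup>2 * (k * (\<gamma> t)\<^sup>2 * (norm (w t))\<^sup>2)"
    by (simp add: power_mult_distrib)
  also have "\<dots> \<le> ?q\<^sup>2 * (\<sigma> t * (norm (w t))\<^sup>2)"
    using \<sigma>_ge(1)[OF t] by (intro mult_left_mono mult_right_mono) (auto simp: k_def)
  also have "\<dots> \<le> 2 * B"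
    using lyap_ge(3)[OF t] lyap_bounded[OF t] by (simp add: B_def weight_square)
  finally have "(?q * (\<gamma> t * norm (w t)))\<^sup>2 \<le> 2 * B / k"
    using k by (simp add: field_simps)
  then have w: "?q * (\<gamma> t * norm (w t)) \<le> sqrt (2 * B / k)"
    by (rule real_le_rsqrt)
  have "norm (v t) = norm (m t - (\<beta>0 * \<gamma> t) *\<^sub>R w t)"
    by (simp add: m_def)
  also have "\<dots> \<le> norm (m t) + \<beta>0 * (\<gamma> t * norm (w t))"
    using norm_triangle_ineq4[of "m t" "(\<beta>0 * \<gamma> t) *\<^sub>R w t"] k \<gamma>_pos[OF t] by simp
  finally have "?q * norm (v t) \<le> ?q * (norm (m t) + \<beta>0 * (\<gamma> t * norm (w t)))"
    by (intro mult_left_mono) auto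
  also have "\<dots> = ?q * norm (m t) + \<beta>0 * (?q * (\<gamma> t * norm (w t)))"
    by (simp add: algebra_simps)
  also have "\<dots> \<le> sqrt (2 * B) + \<beta>0 * sqrt (2 * B / k)"
    using m w k by (intro add_mono mult_left_mono) auto
  finally show "norm (v t) \<le> (sqrt (2 * B) + \<beta>0 * sqrt (2 * B / k)) * exp (- \<beta> * P t)"
    by (simp add: exp_minus field_simps)
qed

end

section \<open>The saddle-point problem as a skew-coupled flow\<close>

lemma smooth_convex_GDERIV:
  fixes f :: "'a::euclidean_space \<Rightarrow> real"
  shows "smooth_convex f \<Longrightarrow> GDERIV f u :> gradient f u"
  unfolding smooth_convex_def by (intro GDERIV_gradient) (auto simp: differentiable_on_def)

lemma smooth_convex_gradient_inequality:
  fixes f :: "'a::euclidean_space \<Rightarrow> real"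
  shows "smooth_convex f \<Longrightarrow> f y \<ge> f u + gradient f u \<bullet> (y - u)"
  by (rule convex_on_gradient_inequality[OF _ smooth_convex_GDERIV]) (auto simp: smooth_convex_def)

locale saddle_point =
  fixes f :: "real^'n1 \<Rightarrow> real" and g :: "real^'n2 \<Rightarrow> real"
    and A :: "real^'n1^'m" and B :: "real^'n2^'m" and b :: "real^'m"
    and xs :: "real^'n1" and ys :: "real^'n2" and ls :: "real^'m"
  assumes f: "smooth_convex f" and g: "smooth_convex g"
    and optimal: "(xs, ys, ls) \<in> Omega f g A B b"
begin

definition res :: "(real^'n1) \<times> (real^'n2) \<times> (real^'m) \<Rightarrow> real^'m" where
  "res u = A *v fst u + B *v fst (snd u) - b"
definition gap :: "(real^'n1) \<times> (real^'n2) \<times> (real^'m) \<Rightarrow> real" where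
  "gap u = aug_lagrangian f g A B b (fst u) (fst (snd u)) ls - aug_lagrangian f g A B b xs ys ls"
definition gap_grad :: "(real^'n1) \<times> (real^'n2) \<times> (real^'m) \<Rightarrow> (real^'n1) \<times> (real^'n2) \<times> (real^'m)" where
  "gap_grad u = (gradient f (fst u) + transpose A *v ls + transpose A *v res u,
     gradient g (fst (snd u)) + transpose B *v ls + transpose B *v res u, 0)"
text \<open>The linear part of the dynamics exchanging primal and dual variables.\<close>
definition coupling :: "(real^'n1) \<times> (real^'n2) \<times> (real^'m) \<Rightarrow> (real^'n1) \<times> (real^'n2) \<times> (real^'m)" where
  "coupling u = (transpose A *v snd (snd u), transpose B *v snd (snd u),
     - (A *v fst u + B *v fst (snd u)))"

lemma kkt:
  "gradient f xs = - (transpose A *v ls)" "gradient g ys = - (transpose B *v ls)" "A *v xs + B *v ys = b"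
  using optimal by (auto simp: Omega_def)

lemma gap_eq: "gap u = (f (fst u) - f xs) + (g (fst (snd u)) - g ys) + ls \<bullet> res u + (res u \<bullet> res u) / 2"
  using kkt(3) by (simp add: gap_def aug_lagrangian_def res_def power2_norm_eq_inner)

lemma res_eq: "res u = A *v (fst u - xs) + B *v (fst (snd u) - ys)"
  using kkt(3) by (simp add: res_def matrix_vector_mult_diff_distrib algebra_simps)

lemma coupling_skew: "coupling u \<bullet> u = 0"
proof -
  obtain a c d where "u = (a, c, d)"
    by (cases u)
  then show ?thesis
    by (simp add: coupling_def dot_lmul_matrix inner_diff_left inner_commute[of "A *v a" d] inner_commute[of "B *v c" d])
qed

lemma gap_deriv: "GDERIV gap u :> gap_grad u"
proof -
  let ?K = "\<lambda>h. A *v fst h + B *v fst (snd h)"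
  have r: "(res has_derivative ?K) (at u)"
    unfolding res_def[abs_def]
    by (auto intro!: derivative_eq_intros bounded_linear.has_derivative[OF matrix_vector_mul_bounded_linear] simp: fun_eq_iff)
  have df: "((\<lambda>u. f (fst u)) has_derivative (\<lambda>h. fst h \<bullet> gradient f (fst u))) (at u)"
    using has_derivative_compose[OF has_derivative_fst[OF has_derivative_ident]
        smooth_convex_GDERIV[OF f, unfolded gderiv_def]] .
  have dg: "((\<lambda>u. g (fst (snd u))) has_derivative (\<lambda>h. fst (snd h) \<bullet> gradient g (fst (snd u)))) (at u)"
    using has_derivative_compose[OF has_derivative_fst[OF has_derivative_snd[OF has_derivative_ident]]
        smooth_convex_GDERIV[OF g, unfolded gderiv_def]] .
  have "((\<lambda>u. (f (fst u) - f xs) + (g (fst (snd u)) - g ys) + ls \<bullet> res u + (res u \<bullet> res u) * (1/2))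
      has_derivative (\<lambda>h. (fst h \<bullet> gradient f (fst u) - 0) + (fst (snd h) \<bullet> gradient g (fst (snd u)) - 0)
        + ls \<bullet> ?K h + (res u \<bullet> ?K h + ?K h \<bullet> res u) * (1/2))) (at u)"
    by (intro has_derivative_add has_derivative_diff has_derivative_const df dg
        has_derivative_inner_right has_derivative_inner has_derivative_mult_left r)
  moreover have "gap = (\<lambda>u. (f (fst u) - f xs) + (g (fst (snd u)) - g ys) + ls \<bullet> res u + (res u \<bullet> res u) * (1/2))"
    by (simp add: fun_eq_iff gap_eq)
  moreover have "(\<lambda>h. (fst h \<bullet> gradient f (fst u) - 0) + (fst (snd h) \<bullet> gradient g (fst (snd u)) - 0)
        + ls \<bullet> ?K h + (res u \<bullet> ?K h + ?K h \<bullet> res u) * (1/2)) = (\<lambda>h. h \<bullet> gap_grad u)"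
  proof
    fix h :: "(real^'n1) \<times> (real^'n2) \<times> (real^'m)"
    have "h \<bullet> gap_grad u = gap_grad u \<bullet> h"
      by (rule inner_commute)
    also have "\<dots> = gradient f (fst u) \<bullet> fst h + gradient g (fst (snd u)) \<bullet> fst (snd h) + ls \<bullet> ?K h + res u \<bullet> ?K h"
      by (simp add: gap_grad_def inner_prod_def inner_add_left dot_lmul_matrix inner_add_right)
    finally show "(fst h \<bullet> gradient f (fst u) - 0) + (fst (snd h) \<bullet> gradient g (fst (snd u)) - 0)
        + ls \<bullet> ?K h + (res u \<bullet> ?K h + ?K h \<bullet> res u) * (1/2) = h \<bullet> gap_grad u"
      by (simp add: inner_commute)
  qed
  ultimately show ?thesis
    by (simp add: gderiv_def)
qed

lemma continuous_on_res: "continuous_on UNIV res"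
  unfolding res_def[abs_def]
  by (intro continuous_intros bounded_linear.continuous_on[OF matrix_vector_mul_bounded_linear])

lemma continuous_on_gap_grad: "continuous_on UNIV gap_grad"
proof -
  have "continuous_on UNIV (gradient f)" "continuous_on UNIV (gradient g)"
    using f g by (auto simp: smooth_convex_def)
  then have "continuous_on UNIV (\<lambda>u::(real^'n1) \<times> (real^'n2) \<times> (real^'m). gradient f (fst u))"
      "continuous_on UNIV (\<lambda>u::(real^'n1) \<times> (real^'n2) \<times> (real^'m). gradient g (fst (snd u)))"
    by (auto intro!: continuous_on_compose2[of UNIV "gradient f"] continuous_on_compose2[of UNIV "gradient g"] continuous_intros)
  then show ?thesis
    unfolding gap_grad_def[abs_def]
    by (intro continuous_on_Pair continuous_on_add continuous_on_const
        bounded_linear.continuous_on[OF matrix_vector_mul_bounded_linear] continuous_on_res)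
qed

text \<open>
  The KKT conditions say that \<open>(xs, ys)\<close> is a minimum point of the convex function
  \<open>f x + g y + ls \<bullet> (A x + B y - b)\<close>, so the gap is at least its quadratic penalty.
\<close>
lemma residual_le_gap: "(norm (res u))\<^sup>2 / 2 \<le> gap u"
proof -
  have "f (fst u) \<ge> f xs - ls \<bullet> (A *v (fst u - xs))"
    using smooth_convex_gradient_inequality[OF f, of xs "fst u"]
    by (simp add: kkt dot_lmul_matrix)
  moreover have "g (fst (snd u)) \<ge> g ys - ls \<bullet> (B *v (fst (snd u) - ys))"
    using smooth_convex_gradient_inequality[OF g, of ys "fst (snd u)"]
    by (simp add: kkt dot_lmul_matrix)
  moreover have "ls \<bullet> res u = ls \<bullet> (A *v (fst u - xs)) + ls \<bullet> (B *v (fst (snd u) - ys))"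
    by (simp add: res_eq inner_add_right)
  ultimately show ?thesis
    by (simp add: gap_eq power2_norm_eq_inner)
qed

text \<open>
  Convexity of \<open>f\<close> and \<open>g\<close> yields the gap once; the quadratic penalty is homogeneous of degree two
  and therefore contributes twice its value, of which half is the surplus on the left.
\<close>
lemma gap_grad_monotone: "gap u + (norm (res u))\<^sup>2 / 2 \<le> gap_grad u \<bullet> (u - (xs, ys, ls))"
proof -
  have "f xs \<ge> f (fst u) - gradient f (fst u) \<bullet> (fst u - xs)"
    using smooth_convex_gradient_inequality[OF f, of "fst u" xs] by (simp add: inner_diff_right)
  moreover have "g ys \<ge> g (fst (snd u)) - gradient g (fst (snd u)) \<bullet> (fst (snd u) - ys)"
    using smooth_convex_gradient_inequality[OF g, of "fst (snd u)" ys] by (simp add: inner_diff_right)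
  moreover have "gap_grad u \<bullet> (u - (xs, ys, ls)) = gradient f (fst u) \<bullet> (fst u - xs)
      + gradient g (fst (snd u)) \<bullet> (fst (snd u) - ys) + ls \<bullet> res u + res u \<bullet> res u"
  proof -
    have "gap_grad u \<bullet> (u - (xs, ys, ls)) = gradient f (fst u) \<bullet> (fst u - xs)
      + gradient g (fst (snd u)) \<bullet> (fst (snd u) - ys)
      + ls \<bullet> (A *v (fst u - xs) + B *v (fst (snd u) - ys)) + res u \<bullet> (A *v (fst u - xs) + B *v (fst (snd u) - ys))"
      by (simp add: gap_grad_def inner_prod_def inner_add_left dot_lmul_matrix inner_add_right)
    then show ?thesis
      by (simp flip: res_eq)
  qed
  ultimately show ?thesis
    by (simp add: gap_eq power2_norm_eq_inner)
qed

end

lemma has_vector_derivative_tderiv: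
  assumes "u differentiable (at t within {t0..})"
  shows "(u has_vector_derivative tderiv t0 u t) (at t within {t0..})"
  using assms unfolding tderiv_def by (simp add: vector_derivative_works)

lemma C1_from_has_vector_derivative:
  assumes "C1_from t0 u" "t \<ge> t0"
  shows "(u has_vector_derivative tderiv t0 u t) (at t within {t0..})"
  using assms by (intro has_vector_derivative_tderiv) (auto simp: C1_from_def differentiable_on_def)

context saddle_point
begin

definition trajectory where "trajectory x y l t = (x t :: real^'n1, y t :: real^'n2, l t :: real^'m)"
  for t :: real

text \<open>
  The exponent \<open>\<beta>\<close> occurs in the hypotheses but not in the dynamics, so one solution may give rise
  to flows with several exponents.
\<close>
lemma damped_skew_flow_of_solution:
  fixes \<gamma> \<delta> :: "real \<Rightarrow> real"
  assumes \<gamma>_pos: "\<forall>t\<ge>t0. \<gamma> t > 0" and anti: "antimono_on {t0..} \<gamma>" and C2: "C2_from t0 \<gamma>"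
    and \<beta>: "0 < \<beta>" "\<beta> \<le> 1/3" and \<gamma>2: "\<forall>t\<ge>t0. tderiv t0 (tderiv t0 \<gamma>) t \<ge> 2 * \<beta>\<^sup>2 * \<gamma> t ^ 3"
    and \<beta>0: "2 * \<beta> \<le> \<beta>0" "\<beta>0 \<le> 1 - \<beta>"
    and \<delta>: "\<forall>t\<ge>t0. \<delta> t = 1 / (\<beta>0 * \<gamma> t)"
    and int: "(\<lambda>t. exp (\<beta> * integral {t0..t} \<gamma>) * (norm (\<epsilon>1 t) + norm (\<epsilon>2 t))) absolutely_integrable_on {t0..}"
    and sol: "global_solution t0 f g A B b \<gamma> \<delta> \<epsilon>1 \<epsilon>2 x y l"
  obtains N where "damped_skew_flow t0 \<beta> \<beta>0 \<gamma> (tderiv t0 \<gamma>) (tderiv t0 (tderiv t0 \<gamma>)) (\<lambda>t. integral {t0..t} \<gamma>)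
    (trajectory x y l) (trajectory (tderiv t0 x) (tderiv t0 y) (tderiv t0 l)) (trajectory \<epsilon>1 \<epsilon>2 (\<lambda>t. 0))
    (\<lambda>t. norm (\<epsilon>1 t) + norm (\<epsilon>2 t)) (xs, ys, ls) gap (\<lambda>u. (norm (res u))\<^sup>2 / 2) gap_grad coupling N"
proof -
  let ?x' = "tderiv t0 x" and ?y' = "tderiv t0 y" and ?l' = "tderiv t0 l"
  note S = sol[unfolded global_solution_def]
  have C1: "C1_from t0 x" "C1_from t0 y" "C1_from t0 l"
    using S by auto
  define ode where "ode = (\<lambda>t. ?x' differentiable (at t within {t0..}) \<and>
        ?y' differentiable (at t within {t0..}) \<and> ?l' differentiable (at t within {t0..}) \<and>
        tderiv t0 ?x' t + \<gamma> t *\<^sub>R ?x' t =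
          - gradient f (x t) - transpose A *v (l t + \<delta> t *\<^sub>R ?l' t)
          - transpose A *v (A *v x t + B *v y t - b) + \<epsilon>1 t \<and>
        tderiv t0 ?y' t + \<gamma> t *\<^sub>R ?y' t =
          - gradient g (y t) - transpose B *v (l t + \<delta> t *\<^sub>R ?l' t)
          - transpose B *v (A *v x t + B *v y t - b) + \<epsilon>2 t \<and>
        tderiv t0 ?l' t + \<gamma> t *\<^sub>R ?l' t =
          A *v (x t + \<delta> t *\<^sub>R ?x' t) + B *v (y t + \<delta> t *\<^sub>R ?y' t) - b)"
  have "AE t in lebesgue. t \<ge> t0 \<longrightarrow> ode t"
    using S by (simp add: ode_def)
  then obtain N where N: "N \<in> null_sets lebesgue" and "\<And>t. t \<in> space lebesgue - N \<Longrightarrow> t \<ge> t0 \<longrightarrow> ode t"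
    by (rule AE_E3) blast
  then have ode_off_N: "ode t" if "t \<ge> t0" "t \<notin> N" for t
    using that by simp
  have \<gamma>C1: "C1_from t0 \<gamma>" "C1_from t0 (tderiv t0 \<gamma>)"
    using C2 by (auto simp: C2_from_def)
  have d1: "(\<gamma> has_real_derivative tderiv t0 \<gamma> t) (at t within {t0..})" if "t \<ge> t0" for t
    using C1_from_has_vector_derivative[OF \<gamma>C1(1) that] by (simp add: has_real_derivative_iff_has_vector_derivative)
  have d2: "(tderiv t0 \<gamma> has_real_derivative tderiv t0 (tderiv t0 \<gamma>) t) (at t within {t0..})" if "t \<ge> t0" for t
    using C1_from_has_vector_derivative[OF \<gamma>C1(2) that] by (simp add: has_real_derivative_iff_has_vector_derivative)
  have \<gamma>_cont: "continuous_on {t0..} \<gamma>"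
    by (rule DERIV_continuous_on) (rule d1, simp)
  have "damped_skew_flow t0 \<beta> \<beta>0 \<gamma> (tderiv t0 \<gamma>) (tderiv t0 (tderiv t0 \<gamma>)) (\<lambda>t. integral {t0..t} \<gamma>)
    (trajectory x y l) (trajectory ?x' ?y' ?l') (trajectory \<epsilon>1 \<epsilon>2 (\<lambda>t. 0))
    (\<lambda>t. norm (\<epsilon>1 t) + norm (\<epsilon>2 t)) (xs, ys, ls) gap (\<lambda>u. (norm (res u))\<^sup>2 / 2) gap_grad coupling N"
  proof
    fix t assume t: "t \<ge> t0"
    show "\<gamma> t > 0" "tderiv t0 (tderiv t0 \<gamma>) t \<ge> 2 * \<beta>\<^sup>2 * \<gamma> t ^ 3"
      using \<gamma>_pos \<gamma>2 t by auto
    show "(\<gamma> has_real_derivative tderiv t0 \<gamma> t) (at t within {t0..})"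
      "(tderiv t0 \<gamma> has_real_derivative tderiv t0 (tderiv t0 \<gamma>) t) (at t within {t0..})"
      by (rule d1[OF t], rule d2[OF t])
    show "tderiv t0 \<gamma> t \<le> 0"
      by (rule antimono_on_imp_deriv_nonpos[OF anti t d1[OF t]])
    show "((\<lambda>t. integral {t0..t} \<gamma>) has_real_derivative \<gamma> t) (at t within {t0..})"
      by (rule integral_has_real_derivative_Ici[OF \<gamma>_cont t])
    show "(trajectory x y l has_vector_derivative trajectory ?x' ?y' ?l' t) (at t within {t0..})"
      unfolding trajectory_def[abs_def]
      by (intro has_vector_derivative_Pair C1_from_has_vector_derivative C1 t)
    show "abs_continuous_on t0 t (trajectory ?x' ?y' ?l')"
      unfolding trajectory_def[abs_def] using S t
      by (intro abs_continuous_on_Pair) (auto simp: loc_abs_continuous_from_def)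
  next
    fix t assume t: "t \<ge> t0" "t \<notin> N"
    note eqs = ode_off_N[OF t, unfolded ode_def]
    have ex: "tderiv t0 ?x' t = - \<gamma> t *\<^sub>R ?x' t - (gradient f (x t) + transpose A *v ls + transpose A *v (A *v x t + B *v y t - b))
        - transpose A *v (l t - ls + \<delta> t *\<^sub>R ?l' t) + \<epsilon>1 t"
      using eqs by (simp add: algebra_simps matrix_vector_right_distrib matrix_vector_mult_diff_distrib)
    have ey: "tderiv t0 ?y' t = - \<gamma> t *\<^sub>R ?y' t - (gradient g (y t) + transpose B *v ls + transpose B *v (A *v x t + B *v y t - b))
        - transpose B *v (l t - ls + \<delta> t *\<^sub>R ?l' t) + \<epsilon>2 t"
      using eqs by (simp add: algebra_simps matrix_vector_right_distrib matrix_vector_mult_diff_distrib)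
    have el: "tderiv t0 ?l' t = - \<gamma> t *\<^sub>R ?l' t - 0
       - (- (A *v (x t - xs + \<delta> t *\<^sub>R ?x' t) + B *v (y t - ys + \<delta> t *\<^sub>R ?y' t))) + 0"
      using eqs kkt(3) by (simp add: algebra_simps matrix_vector_right_distrib matrix_vector_mult_diff_distrib)
    have "(trajectory ?x' ?y' ?l' has_vector_derivative (tderiv t0 ?x' t, tderiv t0 ?y' t, tderiv t0 ?l' t)) (at t within {t0..})"
      unfolding trajectory_def[abs_def] using eqs
      by (intro has_vector_derivative_Pair has_vector_derivative_tderiv) auto
    moreover have "(tderiv t0 ?x' t, tderiv t0 ?y' t, tderiv t0 ?l' t)
      = - \<gamma> t *\<^sub>R trajectory ?x' ?y' ?l' t - gap_grad (trajectory x y l t)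
        - coupling (trajectory x y l t - (xs, ys, ls) + (1 / (\<beta>0 * \<gamma> t)) *\<^sub>R trajectory ?x' ?y' ?l' t)
        + trajectory \<epsilon>1 \<epsilon>2 (\<lambda>t. 0) t"
      unfolding ex ey el using \<delta> t(1) by (simp add: trajectory_def gap_grad_def coupling_def res_def)
    ultimately show "(trajectory ?x' ?y' ?l' has_vector_derivative
        - \<gamma> t *\<^sub>R trajectory ?x' ?y' ?l' t - gap_grad (trajectory x y l t)
        - coupling (trajectory x y l t - (xs, ys, ls) + (1 / (\<beta>0 * \<gamma> t)) *\<^sub>R trajectory ?x' ?y' ?l' t)
        + trajectory \<epsilon>1 \<epsilon>2 (\<lambda>t. 0) t) (at t within {t0..})"
      by simp
  next
    show "continuous_on {t0..} (trajectory ?x' ?y' ?l')"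
      unfolding trajectory_def[abs_def] using C1 by (intro continuous_on_Pair) (auto simp: C1_from_def)
    show "continuous_on {t0..} (tderiv t0 (tderiv t0 \<gamma>))"
      using \<gamma>C1(2) by (simp add: C1_from_def)
    show "negligible N"
      using N by (simp add: negligible_iff_null_sets)
    show "continuous_on UNIV (\<lambda>u. (norm (res u))\<^sup>2 / 2)"
      by (intro continuous_intros continuous_on_res) simp
    fix t
    have "norm (trajectory \<epsilon>1 \<epsilon>2 (\<lambda>t. 0) t) \<le> norm (\<epsilon>1 t) + norm (\<epsilon>2 t, 0 :: real^'m)"
      unfolding trajectory_def by (rule norm_Pair_le)
    then show "norm (trajectory \<epsilon>1 \<epsilon>2 (\<lambda>t. 0) t) \<le> norm (\<epsilon>1 t) + norm (\<epsilon>2 t)"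
      by simp
  qed (use \<beta> \<beta>0 int gap_deriv continuous_on_gap_grad residual_le_gap gap_grad_monotone coupling_skew in auto)
  then show thesis
    by (rule that)
qed

end

section \<open>Convergence rates\<close>

lemma weighted_integrable_mono_exponent:
  fixes P h :: "real \<Rightarrow> real"
  assumes P: "continuous_on {t0..} P" "\<And>t. t \<ge> t0 \<Longrightarrow> P t \<ge> 0" and "\<tau> \<le> \<beta>"
    and h: "(\<lambda>t. exp (\<beta> * P t) * h t) absolutely_integrable_on {t0..}"
  shows "(\<lambda>t. exp (\<tau> * P t) * h t) absolutely_integrable_on {t0..}"
proof -
  have "(\<lambda>t. exp ((\<tau> - \<beta>) * P t) * (exp (\<beta> * P t) * h t)) absolutely_integrable_on {t0..}"
  proof (rule absolutely_integrable_bounded_measurable_product_real[OF _ _ _ h])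
    show "(\<lambda>t. exp ((\<tau> - \<beta>) * P t)) \<in> borel_measurable (lebesgue_on {t0..})"
      by (intro continuous_imp_measurable_on_sets_lebesgue continuous_intros P) simp
    have "exp ((\<tau> - \<beta>) * P t) \<le> 1" if "t \<ge> t0" for t
      using P(2)[OF that] \<open>\<tau> \<le> \<beta>\<close> by (simp add: mult_nonpos_nonneg)
    then show "bounded ((\<lambda>t. exp ((\<tau> - \<beta>) * P t)) ` {t0..})"
      by (auto simp: bounded_iff intro!: exI[of _ 1])
  qed simp
  then show ?thesis
    by (simp add: mult.assoc[symmetric] mult_exp_exp algebra_simps)
qed

theorem theorem4p1:
  fixes t0 \<beta> \<beta>0 :: real
    and f :: "real^'n1 \<Rightarrow> real" and g :: "real^'n2 \<Rightarrow> real"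
    and A :: "real^'n1^'m" and B :: "real^'n2^'m" and b :: "real^'m"
    and \<gamma> \<delta> p :: "real \<Rightarrow> real"
    and \<epsilon>1 :: "real \<Rightarrow> real^'n1" and \<epsilon>2 :: "real \<Rightarrow> real^'n2"
    and x :: "real \<Rightarrow> real^'n1" and y :: "real \<Rightarrow> real^'n2" and l :: "real \<Rightarrow> real^'m"
    and xs :: "real^'n1" and ys :: "real^'n2" and ls :: "real^'m"
  assumes "t0 > 0"
    and "smooth_convex f" and "smooth_convex g"
    and "\<forall>t\<ge>t0. \<gamma> t > 0" and "antimono_on {t0..} \<gamma>" and "C2_from t0 \<gamma>"
    and "0 < \<beta>" and "\<beta> \<le> 1/3"
    and "\<forall>t\<ge>t0. tderiv t0 (tderiv t0 \<gamma>) t \<ge> 2 * \<beta>\<^sup>2 * \<gamma> t ^ 3"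
    and "filterlim (\<lambda>T. integral {t0..T} \<gamma>) at_top at_top"
    and "2 * \<beta> \<le> \<beta>0" and "\<beta>0 \<le> 1 - \<beta>"
    and "\<forall>t\<ge>t0. \<delta> t = 1 / (\<beta>0 * \<gamma> t)"
    and "\<forall>t\<ge>t0. p t = exp (integral {t0..t} \<gamma>)"
    and "loc_integrable_from t0 \<epsilon>1" and "loc_integrable_from t0 \<epsilon>2"
    and "(\<lambda>t. p t powr \<beta> * norm (\<epsilon>1 t)) absolutely_integrable_on {t0..}"
    and "(\<lambda>t. p t powr \<beta> * norm (\<epsilon>2 t)) absolutely_integrable_on {t0..}"
    and "global_solution t0 f g A B b \<gamma> \<delta> \<epsilon>1 \<epsilon>2 x y l"
    and "(xs, ys, ls) \<in> Omega f g A B b"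
  shows
    "(\<lambda>t. aug_lagrangian f g A B b (x t) (y t) ls - aug_lagrangian f g A B b xs ys ls)
        \<in> O[at_top](\<lambda>t. p t powr (- 2 * \<beta>)) \<and>
     (\<lambda>t. norm (A *v x t + B *v y t - b)) \<in> O[at_top](\<lambda>t. p t powr (- \<beta>)) \<and>
     (\<lambda>t. p t powr (2 * \<beta>) * \<gamma> t * (norm (A *v x t + B *v y t - b))\<^sup>2)
        absolutely_integrable_on {t0..} \<and>
     (\<beta> < 1/3 \<and> 2 * \<beta> < \<beta>0 \<and> \<beta>0 < 1 - \<beta> \<longrightarrow>
        (\<lambda>t. p t powr (2 * \<beta>) * \<gamma> t *
             (aug_lagrangian f g A B b (x t) (y t) ls - aug_lagrangian f g A B b xs ys ls))
          absolutely_integrable_on {t0..} \<and>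
        (\<lambda>t. p t powr (2 * \<beta>) * \<gamma> t *
             ((norm (tderiv t0 x t))\<^sup>2 + (norm (tderiv t0 y t))\<^sup>2 + (norm (tderiv t0 l t))\<^sup>2))
          absolutely_integrable_on {t0..} \<and>
        (\<lambda>t. norm (tderiv t0 x t) + norm (tderiv t0 y t) + norm (tderiv t0 l t))
          \<in> O[at_top](\<lambda>t. p t powr (- \<beta>))) \<and>
     (\<beta> = 1/3 \<and> \<beta>0 = 2/3 \<longrightarrow> (\<forall>\<tau>. 0 < \<tau> \<and> \<tau> < 1/3 \<longrightarrow>
        (\<lambda>t. p t powr (2 * \<tau>) * \<gamma> t *
             (aug_lagrangian f g A B b (x t) (y t) ls - aug_lagrangian f g A B b xs ys ls))
          absolutely_integrable_on {t0..} \<and>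
        (\<lambda>t. p t powr (2 * \<tau>) * \<gamma> t *
             ((norm (tderiv t0 x t))\<^sup>2 + (norm (tderiv t0 y t))\<^sup>2 + (norm (tderiv t0 l t))\<^sup>2))
          absolutely_integrable_on {t0..} \<and>
        (\<lambda>t. norm (tderiv t0 x t) + norm (tderiv t0 y t) + norm (tderiv t0 l t))
          \<in> O[at_top](\<lambda>t. p t powr (- \<tau>))))"
proof -
  let ?L = "\<lambda>t. aug_lagrangian f g A B b (x t) (y t) ls - aug_lagrangian f g A B b xs ys ls"
  let ?r = "\<lambda>t. A *v x t + B *v y t - b"
  let ?V2 = "\<lambda>t. (norm (tderiv t0 x t))\<^sup>2 + (norm (tderiv t0 y t))\<^sup>2 + (norm (tderiv t0 l t))\<^sup>2"
  let ?V1 = "\<lambda>t. norm (tderiv t0 x t) + norm (tderiv t0 y t) + norm (tderiv t0 l t)"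
  define P where "P = (\<lambda>t. integral {t0..t} \<gamma>)"
  interpret saddle_point f g A B b xs ys ls
    using assms by unfold_locales
  let ?z = "trajectory x y l" and ?v = "trajectory (tderiv t0 x) (tderiv t0 y) (tderiv t0 l)"
  have gap: "gap (?z t) = ?L t" and res: "res (?z t) = ?r t" for t
    by (simp_all add: gap_def res_def trajectory_def)
  have V2: "(norm (?v t))\<^sup>2 = ?V2 t" for t
    by (simp add: trajectory_def power2_norm_eq_inner)
  have p: "p t powr c = exp (c * P t)" if "t \<ge> t0" for t c
    using assms(14) that by (simp add: P_def powr_def)
  have \<gamma>_cont: "continuous_on {t0..} \<gamma>"
    using assms(6) unfolding C2_from_def C1_from_def by (blast intro: differentiable_imp_continuous_on)
  have \<gamma>_int: "\<gamma> integrable_on {t0..t}" for t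
    by (intro integrable_continuous_real continuous_on_subset[OF \<gamma>_cont]) auto
  have P_nonneg: "P t \<ge> 0" for t
    unfolding P_def using \<gamma>_int assms(4) by (intro integral_nonneg) (auto intro: less_imp_le)
  have \<beta>_int: "(\<lambda>t. exp (\<beta> * P t) * (norm (\<epsilon>1 t) + norm (\<epsilon>2 t))) absolutely_integrable_on {t0..}"
  proof -
    have "(\<lambda>t. p t powr \<beta> * norm (\<epsilon>1 t) + p t powr \<beta> * norm (\<epsilon>2 t)) absolutely_integrable_on {t0..}"
      by (intro set_integral_add assms)
    then show ?thesis
      by (rule set_integrable_cong[THEN iffD1, OF refl refl, rotated]) (simp add: p distrib_left)
  qed
  \<comment> \<open>Every hypothesis on \<open>\<beta>\<close> is inherited by a smaller exponent.\<close>
  have flow: "\<exists>N. damped_skew_flow t0 \<tau> \<beta>0 \<gamma> (tderiv t0 \<gamma>) (tderiv t0 (tderiv t0 \<gamma>)) P ?z ?v (trajectory \<epsilon>1 \<epsilon>2 (\<lambda>t. 0))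
      (\<lambda>t. norm (\<epsilon>1 t) + norm (\<epsilon>2 t)) (xs, ys, ls) gap (\<lambda>u. (norm (res u))\<^sup>2 / 2) gap_grad coupling N"
    if \<tau>: "0 < \<tau>" "\<tau> \<le> \<beta>" for \<tau>
  proof -
    have "continuous_on {t0..} P"
      unfolding P_def
      by (rule DERIV_continuous_on) (rule integral_has_real_derivative_Ici[OF \<gamma>_cont], simp)
    then have int: "(\<lambda>t. exp (\<tau> * P t) * (norm (\<epsilon>1 t) + norm (\<epsilon>2 t))) absolutely_integrable_on {t0..}"
      by (rule weighted_integrable_mono_exponent[OF _ P_nonneg \<tau>(2) \<beta>_int])
    have "2 * \<tau>\<^sup>2 * \<gamma> t ^ 3 \<le> 2 * \<beta>\<^sup>2 * \<gamma> t ^ 3" if "t \<ge> t0" for t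
      using \<tau> assms(4) that by (intro mult_right_mono mult_left_mono power_mono) (auto intro: less_imp_le)
    then have "\<forall>t\<ge>t0. tderiv t0 (tderiv t0 \<gamma>) t \<ge> 2 * \<tau>\<^sup>2 * \<gamma> t ^ 3"
      using assms(9) by (meson order_trans)
    from damped_skew_flow_of_solution[OF assms(4-6) \<tau>(1) _ this _ _ assms(13) int[unfolded P_def] assms(19)]
    show ?thesis
      using \<tau> assms(8,11,12) unfolding P_def by fastforce
  qed
  \<comment> \<open>Used with \<open>\<tau> = \<beta>\<close> if \<open>\<beta>0\<close> is strictly between its bounds, and in the critical case with \<open>\<tau> < \<beta>\<close>,
     for which \<open>2/3\<close> lies strictly between \<open>2 \<tau>\<close> and \<open>1 - \<tau>\<close>.\<close>
  have strict: "(\<lambda>t. p t powr (2 * \<tau>) * \<gamma> t * ?L t) absolutely_integrable_on {t0..} \<and>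
      (\<lambda>t. p t powr (2 * \<tau>) * \<gamma> t * ?V2 t) absolutely_integrable_on {t0..} \<and>
      ?V1 \<in> O[at_top](\<lambda>t. p t powr (- \<tau>))"
    if \<tau>: "0 < \<tau>" "\<tau> \<le> \<beta>" "2 * \<tau> < \<beta>0" "\<beta>0 < 1 - \<tau>" for \<tau>
  proof -
    obtain N where "damped_skew_flow t0 \<tau> \<beta>0 \<gamma> (tderiv t0 \<gamma>) (tderiv t0 (tderiv t0 \<gamma>)) P ?z ?v (trajectory \<epsilon>1 \<epsilon>2 (\<lambda>t. 0))
      (\<lambda>t. norm (\<epsilon>1 t) + norm (\<epsilon>2 t)) (xs, ys, ls) gap (\<lambda>u. (norm (res u))\<^sup>2 / 2) gap_grad coupling N"
      using flow \<tau> by blast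
    then interpret F: damped_skew_flow t0 \<tau> \<beta>0 \<gamma> "tderiv t0 \<gamma>" "tderiv t0 (tderiv t0 \<gamma>)" P ?z ?v "trajectory \<epsilon>1 \<epsilon>2 (\<lambda>t. 0)"
      "\<lambda>t. norm (\<epsilon>1 t) + norm (\<epsilon>2 t)" "(xs, ys, ls)" gap "\<lambda>u. (norm (res u))\<^sup>2 / 2" gap_grad coupling N .
    have "(\<lambda>t. p t powr (2 * \<tau>) * \<gamma> t * ?L t) absolutely_integrable_on {t0..}"
      using F.potential_integrable[OF \<tau>(3)]
      by (rule set_integrable_cong[THEN iffD1, OF refl refl, rotated]) (simp add: p gap)
    moreover have "(\<lambda>t. p t powr (2 * \<tau>) * \<gamma> t * ?V2 t) absolutely_integrable_on {t0..}"
      using F.velocity_integrable[OF \<tau>(4)]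
      by (rule set_integrable_cong[THEN iffD1, OF refl refl, rotated]) (simp only: p V2 atLeast_iff)
    moreover have "?V1 \<in> O[at_top](\<lambda>t. p t powr (- \<tau>))"
    proof -
      obtain K where K: "\<forall>t\<ge>t0. norm (?v t) \<le> K * exp (- \<tau> * P t)"
        using F.velocity_decay[OF \<tau>(4)] by blast
      have "norm (?V1 t) \<le> 3 * K * norm (p t powr (- \<tau>))" if "t \<ge> t0" for t
      proof -
        let ?yl = "(tderiv t0 y t, tderiv t0 l t)"
        have "norm (tderiv t0 x t) \<le> norm (?v t)" "norm ?yl \<le> norm (?v t)"
          "norm (tderiv t0 y t) \<le> norm ?yl" "norm (tderiv t0 l t) \<le> norm ?yl"
          by (simp_all add: trajectory_def norm_fst_le norm_snd_le)
        then have "?V1 t \<le> 3 * norm (?v t)"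
          by linarith
        also have "\<dots> \<le> 3 * (K * exp (- \<tau> * P t))"
          using K that by simp
        finally show ?thesis
          by (simp add: p[OF that])
      qed
      then show ?thesis
        by (intro bigoI[of _ "3 * K"] eventually_at_top_linorderI[of t0]) blast
    qed
    ultimately show ?thesis
      by blast
  qed
  obtain N where "damped_skew_flow t0 \<beta> \<beta>0 \<gamma> (tderiv t0 \<gamma>) (tderiv t0 (tderiv t0 \<gamma>)) P ?z ?v (trajectory \<epsilon>1 \<epsilon>2 (\<lambda>t. 0))
    (\<lambda>t. norm (\<epsilon>1 t) + norm (\<epsilon>2 t)) (xs, ys, ls) gap (\<lambda>u. (norm (res u))\<^sup>2 / 2) gap_grad coupling N"
    using flow[OF assms(7) order_refl] by blast
  then interpret F: damped_skew_flow t0 \<beta> \<beta>0 \<gamma> "tderiv t0 \<gamma>" "tderiv t0 (tderiv t0 \<gamma>)" P ?z ?v "trajectory \<epsilon>1 \<epsilon>2 (\<lambda>t. 0)"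
    "\<lambda>t. norm (\<epsilon>1 t) + norm (\<epsilon>2 t)" "(xs, ys, ls)" gap "\<lambda>u. (norm (res u))\<^sup>2 / 2" gap_grad coupling N .
  obtain K where K: "\<forall>t\<ge>t0. gap (?z t) \<le> K * exp (- 2 * \<beta> * P t)"
    using F.potential_decay by blast
  have "?L \<in> O[at_top](\<lambda>t. p t powr (- 2 * \<beta>))"
  proof (rule bigoI[of _ K], rule eventually_at_top_linorderI[of t0])
    fix t assume t: "t \<ge> t0"
    show "norm (?L t) \<le> K * norm (p t powr (- 2 * \<beta>))"
      using K[rule_format, OF t] F.\<Phi>_nonneg[of "?z t"] by (simp add: p[OF t] gap)
  qed
  moreover have "(\<lambda>t. norm (?r t)) \<in> O[at_top](\<lambda>t. p t powr (- \<beta>))"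
  proof (rule bigoI[of _ "sqrt (2 * K)"], rule eventually_at_top_linorderI[of t0])
    fix t assume t: "t \<ge> t0"
    have "(norm (?r t))\<^sup>2 \<le> 2 * K * exp (- 2 * \<beta> * P t)"
      using K[rule_format, OF t] residual_le_gap[of "?z t"] by (simp add: res)
    then have "norm (?r t) \<le> sqrt (2 * K * exp (- 2 * \<beta> * P t))"
      by (rule real_le_rsqrt)
    also have "\<dots> = sqrt (2 * K) * sqrt ((exp (- \<beta> * P t))\<^sup>2)"
      by (simp only: real_sqrt_mult[symmetric] exp_double[symmetric]) (simp add: mult.assoc)
    finally show "norm (norm (?r t)) \<le> sqrt (2 * K) * norm (p t powr (- \<beta>))"
      by (simp add: p[OF t])
  qed
  moreover have "(\<lambda>t. p t powr (2 * \<beta>) * \<gamma> t * (norm (?r t))\<^sup>2) absolutely_integrable_on {t0..}"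
    using set_integrable_mult_right[of 2, OF F.residual_integrable]
    by (rule set_integrable_cong[THEN iffD1, OF refl refl, rotated]) (simp add: p res)
  moreover note strict[OF assms(7) order_refl]
  moreover have "\<tau> \<le> \<beta> \<and> 2 * \<tau> < \<beta>0 \<and> \<beta>0 < 1 - \<tau>" if "\<beta> = 1/3" "\<beta>0 = 2/3" "\<tau> < 1/3" for \<tau>
    using that by simp
  ultimately show ?thesis
    using strict by blast
qed

end
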